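(* Consider the post-decision Monotone-ADP-Bidding algorithm described in the context, run for $n=1,2,3,\dots$. Suppose: (A4) for each $t\le T-1$ and $s\in\mathcal S^b$, $\alpha^n_t\in[0,1]$ is $\mathcal F^{b,n}$-measurable, and the state-dependent stepsizes $\alpha^n_t(s)=\alpha^{n-1}_t\mathbf 1_{\{s=S^{b,n}_t\}}$ satisfy $\sum_{n}\alpha^n_t(s)=\infty$ and $\sum_{n}\alpha^n_t(s)^2<\infty$ almost surely; (A5) for all $s\in\mathcal S^b$ and $t\le T-1$, $\sum_{n=1}^\infty\mathbf P\bigl(S^{b,n}_t=s\mid\mathcal F^{b,n-1}\bigr)=\infty$ almost surely; (A6) the optimal post-decision value function $V^b_t(s)$ and the observations $\hat v^{b,n}_t(S^{b,n}_t)$ are bounded above and below by $\pm V_{\max}$, where $V_{\max}$ is a positive constant; (A7) the noise sequence satisfies $\mathbf E\bigl[w^{b,n+1}_t(s)\mid\mathcal F^{b,n}\bigr]=0$. Then for each $t\le T-1$ and $s\in\mathcal S^b$, the estimates $\overline V^{b,n}_t(s)$ produced by the algorithm converge to the optimal post-decision value function $V^b_t(s)$ almost surely as $n\to\infty$.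
   Context: **Sets.** Let $M\ge1$ (settlements per hour), $T\ge 1$, $R_{\max},L_{\max}\in\mathbb N$ be integers, $\mathcal R=\{0,\dots,R_{\max}\}$, $\mathcal L=\{0,\dots,L_{\max}\}$, $b_{\max}\ge0$, and let $\mathcal B\subseteq\{(b^-,b^+):0\le b^-\le b^+\le b_{\max}\}$ be a finite set of bids. Let $\beta:\mathcal L\to[0,1]$ be nondecreasing and $K\ge0$. **Transitions.** For $P=(P_1,\dots,P_M)\in\mathbb R^M$ and $b=(b^-,b^+)\in\mathcal B$ let $q_m(P,b)=\mathbf 1_{\{b^+<P_m\}}-\mathbf 1_{\{b^->P_m\}}$ and $d_m(P,b)=\mathbf 1_{\{b^+<P_m\}}$, $m=1,\dots,M$. For $r\in\mathcal R$, $l\in\mathcal L$, $x\in\{-1,0,1\}^M$, $y\in\{0,1\}^M$ let $g^R_0(r,x)=r$, $g^L_0(l,y)=l$, and for $0\le m\le M-1$ $$g^R_{m+1}(r,x)=[\min\{g^R_m(r,x)-x_{m+1},R_{\max}\}]^+,\qquad g^L_{m+1}(l,y)=[g^L_m(l,y)-y_{m+1}]^+.$$ The hourly transitions are $g^R(r,P,b)=g^R_M(r,q(P,b))$ and $g^L(l,P,b)=g^L_M(l,d(P,b))$. **Hourly revenue.** Let $\gamma_m(l,P,b)=\beta(l)\mathbf 1_{\{q_m(P,b)=1\}}+\mathbf 1_{\{q_m(P,b)\ne1\}}$ and $U_m(r,P,b)=1-(K+1)\mathbf 1_{\{r=0\}}\mathbf 1_{\{q_m(P,b)=1\}}$. Define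 $$C(r,l,P,b)=\sum_{m=1}^M\gamma_m\bigl(g^L_m(l,d(P,b)),P,b\bigr)\,P_m\,q_m(P,b)\,U_m\bigl(g^R_m(r,q(P,b)),P,b\bigr).$$ **Prices and states.** Spot prices form a nonnegative stochastic process observed $M$ times per hour; $P_{(t,t+1]}\in\mathbb R_+^M$ is the vector of the $M$ prices in hour $(t,t+1]$. $P^S_t\in\mathcal P$ is the state variable of the price model at time $t$, with $\mathcal P$ a finite set. Prices are exogenous (bids have no price impact): the conditional joint law of $(P_{(t,t+1]},P^S_{t+1},P_{(t+1,t+2]})$ given the state $S_t$ and the bid depends only on $P^S_t$. The state is $S_t=(R_t,L_t,b_{t-1},P^S_t)\in\mathcal S=\mathcal R\times\mathcal L\times\mathcal B\times\mathcal P$, where $b_{t-1}$ is the bid active on $(t,t+1]$. Under decision $b_t\in\mathcal B$ the next state is $$S_{t+1}=\bigl(g^R(R_t,P_{(t,t+1]},b_{t-1}),\;g^L(L_t,P_{(t,t+1]},b_{t-1}),\;b_t,\;P^S_{t+1}\bigr).$$ **Contribution and value functions.** $C_{t,t+2}(S_t,b_t)=\mathbf E[C(R_{t+1},L_{t+1},P_{(t+1,t+2]},b_t)\mid S_t]$. Let $C_{\mathrm{term}}:\mathcal S\to\mathbb R$, $C_{\mathrm{term}}(S_T)$ nondecreasing in $R_T,L_T,b_{T-1}$. Set $V^*_T=C_{\mathrm{term}}$ and $V^*_t(S_t)=\max_{b_t\in\mathcal B}[C_{t,t+2}(S_t,b_t)+\mathbf E[V^*_{t+1}(S_{t+1})\mid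 S_t,b_t]]$, $t=0,\dots,T-1$. The post-decision state is $S^b_t=(S_t,b_t)\in\mathcal S^b=\mathcal S\times\mathcal B$, written $(R_t,L_t,b_{t-1},b_t,P^S_t)$, and $V^b_t(S^b_t)=\mathbf E[V^*_{t+1}(S_{t+1})\mid S^b_t]$ for $t=0,\dots,T-1$ (so $V^b_{T-1}(s)=\mathbf E[C_{\mathrm{term}}(S_T)\mid S^b_{T-1}=s]$). All expectations are assumed finite. **Partial order and monotonicity operator.** For $s=(r,l,b_1,b_2,p)$, $s'=(r',l',b_1',b_2',p')$ in $\mathcal S^b$ write $s\preccurlyeq^b s'$ iff $(r,l,b_1,b_2)\le(r',l',b_1',b_2')$ componentwise and $p=p'$. For $x,s\in\mathcal S^b$ and $z,v\in\mathbb R$, $$\Pi^b_M(x,z,s,v)=\begin{cases}z&s=x,\\ \max\{z,v\}&x\preccurlyeq^b s,\ s\ne x,\\ \min\{z,v\}&s\preccurlyeq^b x,\ s\ne x,\\ v&\text{otherwise.}\end{cases}$$ **Algorithm.** Initialize $\overline V^{b,0}_t(s)=0$ for $t\le T-2$, $s\in\mathcal S^b$, and set $\overline V^{b,n}_{T-1}(s)=V^b_{T-1}(s)$ for all $n\ge 0$. In each iteration $n=1,2,\dots$: select an initial post-decision state $S^{b,n}_0\in\mathcal S^b$; then for $t=0,\dots,T-2$: (2a) sample a noisy observation $$\hat v^{b,n}_t(S^{b,n}_t)=\mathbf E\Bigl[\max_{b_{t+1}\in\mathcal B}\bigl[C_{t+1,t+3}(S_{t+1},b_{t+1})+\overline V^{b,n-1}_{t+1}(S_{t+1},b_{t+1})\bigr]\,\Big|\,S^{b,n}_t\Bigr]+w^{b,n}_t(S^{b,n}_t),$$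 where the conditional expectation is over the transition from the post-decision state $S^{b,n}_t$ to $S_{t+1}$ (with $\overline V^{b,n-1}$ fixed) and $w^{b,n}_t(\cdot)$ is the observation noise; (2b) smooth: $z^{b,n}_t=\bigl(1-\alpha^n_t(S^{b,n}_t)\bigr)\overline V^{b,n-1}_t(S^{b,n}_t)+\alpha^n_t(S^{b,n}_t)\,\hat v^{b,n}_t(S^{b,n}_t)$; (2c) for each $s\in\mathcal S^b$ set $\overline V^{b,n}_t(s)=\Pi^b_M\bigl(S^{b,n}_t,z^{b,n}_t,s,\overline V^{b,n-1}_t(s)\bigr)$; (2d) choose the next state $S^{b,n}_{t+1}\in\mathcal S^b$ given $\mathcal F^{b,n-1}$. Here $(\alpha^n_t)_{n\ge0}$ is a (possibly stochastic) stepsize sequence for each $t$, $\alpha^n_t(s)=\alpha^{n-1}_t\mathbf 1_{\{s=S^{b,n}_t\}}$ for $n\ge1$, and the filtration is $\mathcal F^{b,n}=\sigma\{(S^{b,m}_t,w^{b,m}_t(S^{b,m}_t)):m\le n,\ t\le T\}$ (over those indices for which the quantities are defined).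
   Formalization: As stated the claim can fail when K>0 and β is nonconstant, since V^b_t need not increase in L; in that case V^b_t (t≤T−2) is assumed monotone for the partial order. Choosing states given F^{b,n−1} is read as conditional independence of the visit to s and the noise at s. *)

theory Defs
  imports "HOL-Probability.Probability"
begin

section \<open>Model data\<close>

text \<open>A bid is a pair (b-, b+); a price vector lists the prices at indices 1, ..., M.\<close>

type_synonym bid = "real \<times> real"
type_synonym price = "nat \<Rightarrow> real"
type_synonym 'p state = "nat \<times> nat \<times> bid \<times> 'p"
type_synonym 'p post_state = "nat \<times> nat \<times> bid \<times> bid \<times> 'p"

text \<open>
  \<open>price_law D t p\<close> is the conditional joint law of (prices in hour (t, t+1], price state at t+1,
  prices in hour (t+1, t+2]) given that the price state at time t is p. By exogeneity this is also
  its conditional law given the full state and the bid, so it is all that the value functions use.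
\<close>

record 'p bidding_model =
  settlements :: nat
  horizon :: nat
  Rmax :: nat
  Lmax :: nat
  bmax :: real
  bids :: "bid set"
  beta :: "nat \<Rightarrow> real"
  penalty :: real
  price_states :: "'p set"
  price_law :: "nat \<Rightarrow> 'p \<Rightarrow> (price \<times> 'p \<times> price) measure"
  Cterm :: "'p state \<Rightarrow> real"

definition bid_le :: "bid \<Rightarrow> bid \<Rightarrow> bool" where
  "bid_le b b' \<longleftrightarrow> fst b \<le> fst b' \<and> snd b \<le> snd b'"

definition states :: "('p, 'z) bidding_model_scheme \<Rightarrow> 'p state set" where
  "states D = {..Rmax D} \<times> {..Lmax D} \<times> bids D \<times> price_states D"

definition post_states :: "('p, 'z) bidding_model_scheme \<Rightarrow> 'p post_state set" where
  "post_states D = {..Rmax D} \<times> {..Lmax D} \<times> bids D \<times> bids D \<times> price_states D"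

definition post_le :: "'p post_state \<Rightarrow> 'p post_state \<Rightarrow> bool" where
  "post_le x s = (case x of (r, l, b1, b2, p) \<Rightarrow> case s of (r', l', b1', b2', p') \<Rightarrow>
     r \<le> r' \<and> l \<le> l' \<and> bid_le b1 b1' \<and> bid_le b2 b2' \<and> p = p')"

section \<open>Transitions and revenue\<close>

definition q_at :: "price \<Rightarrow> bid \<Rightarrow> nat \<Rightarrow> int" where
  "q_at P b m = of_bool (snd b < P m) - of_bool (fst b > P m)"

definition d_at :: "price \<Rightarrow> bid \<Rightarrow> nat \<Rightarrow> int" where
  "d_at P b m = of_bool (snd b < P m)"

primrec gR_step :: "('p, 'z) bidding_model_scheme \<Rightarrow> nat \<Rightarrow> nat \<Rightarrow> (nat \<Rightarrow> int) \<Rightarrow> nat" where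
  "gR_step D 0 r x = r"
| "gR_step D (Suc m) r x = nat (max 0 (min (int (gR_step D m r x) - x (Suc m)) (int (Rmax D))))"

primrec gL_step :: "nat \<Rightarrow> nat \<Rightarrow> (nat \<Rightarrow> int) \<Rightarrow> nat" where
  "gL_step 0 l y = l"
| "gL_step (Suc m) l y = nat (max 0 (int (gL_step m l y) - y (Suc m)))"

definition gR :: "('p, 'z) bidding_model_scheme \<Rightarrow> nat \<Rightarrow> price \<Rightarrow> bid \<Rightarrow> nat" where
  "gR D r P b = gR_step D (settlements D) r (q_at P b)"

definition gL :: "('p, 'z) bidding_model_scheme \<Rightarrow> nat \<Rightarrow> price \<Rightarrow> bid \<Rightarrow> nat" where
  "gL D l P b = gL_step (settlements D) l (d_at P b)"

definition gamma_at :: "('p, 'z) bidding_model_scheme \<Rightarrow> nat \<Rightarrow> nat \<Rightarrow> price \<Rightarrow> bid \<Rightarrow> real" where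
  "gamma_at D m l P b = beta D l * of_bool (q_at P b m = 1) + of_bool (q_at P b m \<noteq> 1)"

definition U_at :: "('p, 'z) bidding_model_scheme \<Rightarrow> nat \<Rightarrow> nat \<Rightarrow> price \<Rightarrow> bid \<Rightarrow> real" where
  "U_at D m r P b = 1 - (penalty D + 1) * of_bool (r = 0) * of_bool (q_at P b m = 1)"

definition revenue :: "('p, 'z) bidding_model_scheme \<Rightarrow> nat \<Rightarrow> nat \<Rightarrow> price \<Rightarrow> bid \<Rightarrow> real" where
  "revenue D r l P b = (\<Sum>m = 1..settlements D.
     gamma_at D m (gL_step m l (d_at P b)) P b * P m * of_int (q_at P b m) * U_at D m (gR_step D m r (q_at P b)) P b)"

section \<open>Contribution and value functions\<close>

text \<open>\<open>next_state\<close> takes the prices of the coming hour and the price state at its end.\<close>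

fun next_state :: "('p, 'z) bidding_model_scheme \<Rightarrow> 'p post_state \<Rightarrow> price \<Rightarrow> 'p \<Rightarrow> 'p state" where
  "next_state D (r, l, b1, b2, p) P p' = (gR D r P b1, gL D l P b1, b2, p')"

fun to_post :: "'p state \<Rightarrow> bid \<Rightarrow> 'p post_state" where
  "to_post (r, l, b1, p) b = (r, l, b1, b, p)"

fun contribution :: "('p, 'z) bidding_model_scheme \<Rightarrow> nat \<Rightarrow> 'p state \<Rightarrow> bid \<Rightarrow> real" where
  "contribution D t (r, l, b1, p) b =
     (\<integral>(P, p', P'). revenue D (gR D r P b1) (gL D l P b1) P' b \<partial>price_law D t p)"

text \<open>Expected value, over the transition out of a post-decision state at time t, of a function of
  the next pre-decision state.\<close>

definition expect_next ::
  "('p, 'z) bidding_model_scheme \<Rightarrow> nat \<Rightarrow> ('p state \<Rightarrow> real) \<Rightarrow> 'p post_state \<Rightarrow> real" where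
  "expect_next D t f x = (case x of (r, l, b1, b2, p) \<Rightarrow>
     (\<integral>(P, p', P'). f (next_state D x P p') \<partial>price_law D t p))"

function Vstar :: "('p, 'z) bidding_model_scheme \<Rightarrow> nat \<Rightarrow> 'p state \<Rightarrow> real" where
  "Vstar D t = (if t < horizon D
     then (\<lambda>s. Max ((\<lambda>b. contribution D t s b + expect_next D t (Vstar D (Suc t)) (to_post s b)) ` bids D))
     else Cterm D)"
  by pat_completeness auto
termination by (relation "Wellfounded.measure (\<lambda>(D, t). horizon D - t)") auto

declare Vstar.simps [simp del]

definition Vpost :: "('p, 'z) bidding_model_scheme \<Rightarrow> nat \<Rightarrow> 'p post_state \<Rightarrow> real" where
  "Vpost D t = expect_next D t (Vstar D (Suc t))"

section \<open>Standing assumptions on the model\<close>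

definition price_space :: "('p, 'z) bidding_model_scheme \<Rightarrow> price measure" where
  "price_space D = (\<Pi>\<^sub>M m\<in>{1..settlements D}. borel)"

text \<open>In the finiteness assumption only the contribution needs to be mentioned: all other
  expectations are of functions that take finitely many values.\<close>

definition bidding_problem :: "('p, 'z) bidding_model_scheme \<Rightarrow> bool" where
  "bidding_problem D \<longleftrightarrow>
     1 \<le> settlements D \<and> 1 \<le> horizon D \<and> 0 \<le> bmax D \<and> 0 \<le> penalty D \<and>
     finite (bids D) \<and> bids D \<subseteq> {(bm, bp). 0 \<le> bm \<and> bm \<le> bp \<and> bp \<le> bmax D} \<and>
     beta D ` {..Lmax D} \<subseteq> {0..1} \<and> mono_on {..Lmax D} (beta D) \<and>
     finite (price_states D) \<and>
     (\<forall>t < horizon D. \<forall>p \<in> price_states D.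
        prob_space (price_law D t p) \<and>
        sets (price_law D t p) =
          sets (price_space D \<Otimes>\<^sub>M (count_space (price_states D) \<Otimes>\<^sub>M price_space D)) \<and>
        (AE (P, p', P') in price_law D t p. \<forall>m \<in> {1..settlements D}. 0 \<le> P m \<and> 0 \<le> P' m) \<and>
        (\<forall>r \<le> Rmax D. \<forall>l \<le> Lmax D. \<forall>b1 \<in> bids D. \<forall>b \<in> bids D.
           integrable (price_law D t p)
             (\<lambda>(P, p', P'). revenue D (gR D r P b1) (gL D l P b1) P' b))) \<and>
     (\<forall>r l b r' l' b' p. (r, l, b, p) \<in> states D \<longrightarrow> (r', l', b', p) \<in> states D \<longrightarrow>
        r \<le> r' \<longrightarrow> l \<le> l' \<longrightarrow> bid_le b b' \<longrightarrow> Cterm D (r, l, b, p) \<le> Cterm D (r', l', b', p))"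

section \<open>The algorithm\<close>

definition mono_op :: "'p post_state \<Rightarrow> real \<Rightarrow> 'p post_state \<Rightarrow> real \<Rightarrow> real" where
  "mono_op x z s v =
     (if s = x then z else if post_le x s then max z v else if post_le s x then min z v else v)"

text \<open>
  Indexing: \<open>S n t \<omega>\<close> is the post-decision state visited at time t of iteration n,
  \<open>w n t s \<omega>\<close> the observation noise, and \<open>\<alpha> n t \<omega>\<close> the stepsize.
  \<open>observation D v t x e\<close> is the observation made at x when v is the previous estimate at
  time t+1 and e is the noise.
\<close>

definition observation ::
  "('p, 'z) bidding_model_scheme \<Rightarrow> ('p post_state \<Rightarrow> real) \<Rightarrow> nat \<Rightarrow> 'p post_state \<Rightarrow> real \<Rightarrow> real" where
  "observation D v t x e =
     expect_next D t (\<lambda>s. Max ((\<lambda>b. contribution D (Suc t) s b + v (to_post s b)) ` bids D)) x + e"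

definition state_step ::
  "(nat \<Rightarrow> nat \<Rightarrow> 'w \<Rightarrow> real) \<Rightarrow> (nat \<Rightarrow> nat \<Rightarrow> 'w \<Rightarrow> 'p post_state) \<Rightarrow> nat \<Rightarrow> nat \<Rightarrow> 'p post_state \<Rightarrow> 'w \<Rightarrow> real" where
  "state_step \<alpha> S n t s \<omega> = \<alpha> (n - 1) t \<omega> * of_bool (s = S n t \<omega>)"

primrec Vbar ::
  "('p, 'z) bidding_model_scheme \<Rightarrow> (nat \<Rightarrow> nat \<Rightarrow> 'w \<Rightarrow> real) \<Rightarrow> (nat \<Rightarrow> nat \<Rightarrow> 'w \<Rightarrow> 'p post_state) \<Rightarrow>
   (nat \<Rightarrow> nat \<Rightarrow> 'p post_state \<Rightarrow> 'w \<Rightarrow> real) \<Rightarrow> nat \<Rightarrow> 'w \<Rightarrow> nat \<Rightarrow> 'p post_state \<Rightarrow> real" where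
  "Vbar D \<alpha> S w 0 \<omega> = (\<lambda>t s. if Suc t < horizon D then 0 else Vpost D t s)"
| "Vbar D \<alpha> S w (Suc n) \<omega> = (\<lambda>t s.
     if Suc t < horizon D
     then let x = S (Suc n) t \<omega>;
              a = state_step \<alpha> S (Suc n) t x \<omega>;
              v = Vbar D \<alpha> S w n \<omega>;
              obs = observation D (v (Suc t)) t x (w (Suc n) t x \<omega>);
              z = (1 - a) * v t x + a * obs
          in mono_op x z s (v t s)
     else Vpost D t s)"

text \<open>The observation made at time t of iteration n, n at least 1.\<close>

definition vhat ::
  "('p, 'z) bidding_model_scheme \<Rightarrow> (nat \<Rightarrow> nat \<Rightarrow> 'w \<Rightarrow> real) \<Rightarrow> (nat \<Rightarrow> nat \<Rightarrow> 'w \<Rightarrow> 'p post_state) \<Rightarrow>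
   (nat \<Rightarrow> nat \<Rightarrow> 'p post_state \<Rightarrow> 'w \<Rightarrow> real) \<Rightarrow> nat \<Rightarrow> nat \<Rightarrow> 'w \<Rightarrow> real" where
  "vhat D \<alpha> S w n t \<omega> =
     observation D (Vbar D \<alpha> S w (n - 1) \<omega> (Suc t)) t (S n t \<omega>) (w n t (S n t \<omega>) \<omega>)"

text \<open>
  The algorithm visits a state for every t < T but observes only for t < T - 1, so these are the
  generators of the filtration; there are no generators at n = 0.
\<close>

definition filt ::
  "('p, 'z) bidding_model_scheme \<Rightarrow> 'w measure \<Rightarrow> (nat \<Rightarrow> nat \<Rightarrow> 'w \<Rightarrow> 'p post_state) \<Rightarrow>
   (nat \<Rightarrow> nat \<Rightarrow> 'p post_state \<Rightarrow> 'w \<Rightarrow> real) \<Rightarrow> nat \<Rightarrow> 'w measure" where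
  "filt D N S w n = sigma (space N)
     ({S m t -` {s} \<inter> space N | m t s. m \<in> {1..n} \<and> t < horizon D \<and> s \<in> post_states D} \<union>
      {(\<lambda>\<omega>. w m t (S m t \<omega>) \<omega>) -` A \<inter> space N | m t A.
         m \<in> {1..n} \<and> Suc t < horizon D \<and> A \<in> sets borel})"

definition prob_given :: "'w measure \<Rightarrow> 'w measure \<Rightarrow> 'w set \<Rightarrow> 'w \<Rightarrow> real" where
  "prob_given N F A = real_cond_exp N F (indicator A)"

text \<open>
  The last conjunct is the meaning of choosing the states of iteration n+1 ``given'' the
  information of iteration n: conditionally on that information, whether s is visited at time t
  does not depend on the noise that would be observed at s. This allows both a choice that is a
  function of the past and a choice that uses fresh randomness.
\<close>

definition adp_run ::
  "('p, 'z) bidding_model_scheme \<Rightarrow> 'w measure \<Rightarrow> (nat \<Rightarrow> nat \<Rightarrow> 'w \<Rightarrow> 'p post_state) \<Rightarrow>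
   (nat \<Rightarrow> nat \<Rightarrow> 'p post_state \<Rightarrow> 'w \<Rightarrow> real) \<Rightarrow> bool" where
  "adp_run D N S w \<longleftrightarrow>
     prob_space N \<and>
     (\<forall>n \<ge> 1. \<forall>t < horizon D. S n t \<in> measurable N (count_space (post_states D))) \<and>
     (\<forall>n \<ge> 1. \<forall>t. Suc t < horizon D \<longrightarrow> (\<forall>s \<in> post_states D. w n t s \<in> borel_measurable N)) \<and>
     (\<forall>n t. Suc t < horizon D \<longrightarrow> (\<forall>s \<in> post_states D. \<forall>A \<in> sets borel.
        let F = filt D N S w n;
            visit = {\<omega> \<in> space N. S (Suc n) t \<omega> = s};
            noise = {\<omega> \<in> space N. w (Suc n) t s \<omega> \<in> A}
        in AE \<omega> in N. prob_given N F (visit \<inter> noise) \<omega> = prob_given N F visit \<omega> * prob_given N F noise \<omega>))"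

section \<open>Monotonicity of the optimal value function\<close>

text \<open>
  The term of the revenue at settlement m with a sale and an empty battery is
  \<open>- penalty D * beta D l * P m\<close>, which is decreasing in l. So the optimal value function is
  monotone if the penalty vanishes or beta is constant, but not in general. Without monotonicity
  the monotone estimates cannot converge to it, as the lemma below shows.
\<close>

definition value_monotone :: "('p, 'z) bidding_model_scheme \<Rightarrow> bool" where
  "value_monotone D \<longleftrightarrow> (\<forall>t. Suc t < horizon D \<longrightarrow>
     (\<forall>x \<in> post_states D. \<forall>s \<in> post_states D. post_le x s \<longrightarrow> Vpost D t x \<le> Vpost D t s))"

lemma Vbar_at_visit_le:
  assumes "Suc t < horizon D" "S (Suc n) t \<omega> = x" "post_le x s"
  shows "Vbar D \<alpha> S w (Suc n) \<omega> t x \<le> Vbar D \<alpha> S w (Suc n) \<omega> t s"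
  using assms by (auto simp: mono_op_def Let_def)

lemma convergence_imp_monotone:
  assumes "prob_space N" "Suc t < horizon D" "post_le x s"
    and visits: "AE \<omega> in N. (\<Sum>n. ennreal (state_step \<alpha> S (Suc n) t x \<omega>)) = \<infinity>"
    and x: "AE \<omega> in N. (\<lambda>n. Vbar D \<alpha> S w n \<omega> t x) \<longlonglongrightarrow> Vpost D t x"
    and s: "AE \<omega> in N. (\<lambda>n. Vbar D \<alpha> S w n \<omega> t s) \<longlonglongrightarrow> Vpost D t s"
  shows "Vpost D t x \<le> Vpost D t s"
proof -
  interpret prob_space N by fact
  have "AE \<omega> in N. Vpost D t x \<le> Vpost D t s"
    using visits x s
  proof eventually_elim
    case (elim \<omega>)
    have inf: "\<exists>n\<ge>k. S (Suc n) t \<omega> = x" for k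
    proof (rule ccontr)
      assume *: "\<not> ?thesis"
      have "(\<Sum>n. ennreal (state_step \<alpha> S (Suc n) t x \<omega>)) =
            (\<Sum>n<k. ennreal (state_step \<alpha> S (Suc n) t x \<omega>))"
      proof (rule suminf_finite)
        fix n assume "n \<notin> {..<k}"
        then have "S (Suc n) t \<omega> \<noteq> x" using * by auto
        then show "ennreal (state_step \<alpha> S (Suc n) t x \<omega>) = 0"
          by (auto simp: state_step_def)
      qed simp
      also have "\<dots> < \<infinity>"
        by (auto simp: less_top[symmetric])
      finally show False using elim(1) by simp
    qed
    define f where "f n = Vbar D \<alpha> S w n \<omega> t s - Vbar D \<alpha> S w n \<omega> t x" for n
    have lim: "f \<longlonglongrightarrow> Vpost D t s - Vpost D t x"
      unfolding f_def using elim by (intro tendsto_diff)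
    show ?case
    proof (rule ccontr)
      assume "\<not> ?case"
      then have "\<forall>\<^sub>F n in sequentially. f n < 0"
        using order_tendstoD(2)[OF lim, of 0] by simp
      then obtain k where k: "\<And>n. n \<ge> k \<Longrightarrow> f n < 0"
        by (auto simp: eventually_sequentially)
      obtain n where "n \<ge> k" "S (Suc n) t \<omega> = x" using inf by blast
      then show False
        using Vbar_at_visit_le[OF assms(2) _ assms(3), of S n \<omega> \<alpha> w] k[of "Suc n"]
        by (simp add: f_def)
    qed
  qed
  then show ?thesis by simp
qed

end

theory Submission
  imports Defs
begin

text \<open>
  Fix an outcome and a time t, and proceed backwards in t. Write V for the optimal post-decision
  value function at t. If the estimates at t+1 converge to the optimal values there, then the
  noise-free part of the observations at t converges to V, because the Bellman step is continuous
  on functions on a finite set. What remains is a relaxation scheme: the visited state x moves towards its observation,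
  states above x are raised to the new estimate of x if they lie below it, and states below x are
  lowered to it if they lie above it.

  This scheme converges to V for every path on which, for each state s, the stepsizes used at s have
  an infinite sum and the stepsize-weighted noise at s has a convergent series
  (\<open>monotone_relaxation_tendsto\<close>). For the upper bound at s the lowerings may be ignored, and a
  raise of s comes from a state below s. By induction along the partial order, the estimates of the
  states below s are eventually at most a little above their own values of V, which are at most V(s)
  since V is monotone. So raises cannot push s far above V(s), and the steps at s itself pull it down
  to V(s) up to a noise term that vanishes. The lower bound is the upper bound for the negated
  estimates in the reversed order. No probability enters here.

  The convergence of the weighted noise series is the probabilistic part. Its terms are martingale
  differences: the noise at s has conditional mean zero and is conditionally independent of the
  decision to visit s, so it still has conditional mean zero when restricted to the visit
  (\<open>cond_exp_indicator_times_zero\<close>). They are bounded, because the observations and hence the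
  estimates are bounded by Vmax. Square-summable stepsizes make their sum of squares finite, and
  a martingale with bounded differences converges where its sum of squared differences is finite
  (\<open>AE_summable_martingale_differences\<close>).

  Monotonicity of V follows, if the penalty vanishes or beta is constant, because then the revenue is
  nondecreasing in the energy level and the remaining battery life, and all transitions preserve the order
  (\<open>value_monotone_sufficient\<close>).
\<close>

section \<open>Relaxation with monotone projection along one path\<close>

text \<open>
  The factors satisfy \<open>1 - a \<le> exp (- a)\<close>, so the product of the factors is at most the exponential of
  minus a divergent sum.
\<close>

lemma damped_tendsto_zero:
  fixes u a :: "nat \<Rightarrow> real"
  assumes u: "\<And>n. 0 \<le> u n" and a: "\<And>n. a n \<in> {0..1}" and div: "\<not> summable a"
    and step: "\<And>n. n \<ge> m \<Longrightarrow> u (Suc n) \<le> (1 - a n) * u n"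
  shows "u \<longlonglongrightarrow> 0"
proof -
  define A where "A k = (\<Sum>i<k. a (i + m))" for k
  have bound: "u (k + m) \<le> u m * exp (- A k)" for k
  proof (induction k)
    case (Suc k)
    have "u (Suc k + m) \<le> (1 - a (k + m)) * u (k + m)"
      using step[of "k + m"] by simp
    also have "\<dots> \<le> exp (- a (k + m)) * (u m * exp (- A k))"
      using a[of "k + m"] u exp_ge_add_one_self[of "- a (k + m)"] Suc.IH by (intro mult_mono) auto
    also have "\<dots> = u m * exp (- A (Suc k))"
      by (simp add: A_def exp_diff exp_minus field_simps)
    finally show ?case .
  qed (simp add: A_def)
  have nsum: "\<not> summable (\<lambda>i. a (i + m))"
    using div by simp
  have "filterlim A at_top sequentially"
    unfolding filterlim_at_top
  proof
    fix C
    obtain k where k: "C < A k"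
      using nsum summableI_nonneg_bounded[of "\<lambda>i. a (i + m)" C] a unfolding A_def
      by (meson atLeastAtMost_iff not_le)
    have "C \<le> A n" if "k \<le> n" for n
    proof -
      have "A k \<le> A n"
        unfolding A_def using that a by (intro sum_mono2) auto
      with k show ?thesis by simp
    qed
    then show "\<forall>\<^sub>F n in sequentially. C \<le> A n"
      by (auto simp: eventually_sequentially)
  qed
  then have "((\<lambda>k. exp (- A k)) \<longlongrightarrow> 0) sequentially"
    by (intro filterlim_compose[OF exp_at_bot] filterlim_compose[OF filterlim_uminus_at_bot_at_top])
  then have "(\<lambda>k. u m * exp (- A k)) \<longlonglongrightarrow> 0"
    using tendsto_mult_right_zero by blast
  then have "(\<lambda>k. u (k + m)) \<longlonglongrightarrow> 0"
    by (rule tendsto_sandwich[OF always_eventually always_eventually tendsto_const, rotated 2])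
       (simp_all only: u bound simp_thms)
  then show ?thesis
    by (rule LIMSEQ_offset)
qed

text \<open>
  A sequence that is pulled towards c with total weight infinity, and may be reset to any value up to
  c, ends up below every level above c. The excess over c is a damped sequence. The resets are what
  the raises by the projection look like from a single state.
\<close>

lemma relaxation_eventually_less:
  fixes e a :: "nat \<Rightarrow> real"
  assumes a: "\<And>n. a n \<in> {0..1}" and div: "\<not> summable a"
    and step: "\<forall>\<^sub>F n in sequentially. e (Suc n) \<le> max c ((1 - a n) * e n + a n * c)"
    and "c < d"
  shows "\<forall>\<^sub>F n in sequentially. e n < d"
proof -
  obtain m where m: "\<And>n. n \<ge> m \<Longrightarrow> e (Suc n) \<le> max c ((1 - a n) * e n + a n * c)"
    using step by (auto simp: eventually_sequentially)
  have "(\<lambda>n. max 0 (e n - c)) \<longlonglongrightarrow> 0"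
  proof (rule damped_tendsto_zero[where a = a and m = m])
    fix n assume "n \<ge> m"
    have "e (Suc n) - c \<le> max 0 ((1 - a n) * (e n - c))"
      using m[OF \<open>n \<ge> m\<close>] by (auto simp: max_def algebra_simps split: if_splits)
    also have "\<dots> \<le> (1 - a n) * max 0 (e n - c)"
      using a[of n] by (auto intro!: mult_left_mono)
    finally show "max 0 (e (Suc n) - c) \<le> (1 - a n) * max 0 (e n - c)"
      using a[of n] by auto
  qed (use a div in auto)
  then show ?thesis
    using \<open>c < d\<close> by (auto dest!: order_tendstoD(2)[where a = "d - c"] elim: eventually_mono)
qed

text \<open>
  Adding to y the remaining tail R of the noise series turns noise into averaging:
  \<open>y + R\<close> is a relaxation towards R itself, and R vanishes.
\<close>

lemma relaxed_noise_tendsto_zero: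
  fixes a :: "nat \<Rightarrow> real"
  assumes a: "\<And>n. a n \<in> {0..1}" and div: "\<not> summable a" and sum: "summable \<epsilon>"
    and step: "\<And>n. y (Suc n) = (1 - a n) * y n + \<epsilon> n"
  shows "y \<longlonglongrightarrow> 0"
proof -
  define R where "R n = (\<Sum>k. \<epsilon> (k + n))" for n
  have R0: "R \<longlonglongrightarrow> 0"
    unfolding R_def using sum by (rule suminf_exist_split2)
  have R: "R n = \<epsilon> n + R (Suc n)" for n
    using suminf_split_head[OF summable_ignore_initial_segment[OF sum, of n]]
    by (simp add: R_def)
  have less: "\<forall>\<^sub>F n in sequentially. s * (y n + R n) < d" if "s = 1 \<or> s = -1" "0 < d" for s d :: real
  proof (rule relaxation_eventually_less[OF a div])
    show "d / 2 < d" using that by simp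
    have "\<forall>\<^sub>F n in sequentially. s * R n < d / 2"
      using that R0 order_tendstoD(2)[OF tendsto_mult_left[OF R0, of s], of "d / 2"] by simp
    then show "\<forall>\<^sub>F n in sequentially.
        s * (y (Suc n) + R (Suc n)) \<le> max (d / 2) ((1 - a n) * (s * (y n + R n)) + a n * (d / 2))"
    proof eventually_elim
      case (elim n)
      have "s * (y (Suc n) + R (Suc n)) = (1 - a n) * (s * (y n + R n)) + a n * (s * R n)"
        unfolding step[of n] R[of n] by (simp add: algebra_simps)
      also have "\<dots> \<le> (1 - a n) * (s * (y n + R n)) + a n * (d / 2)"
        using elim a[of n] by (intro add_left_mono mult_left_mono) auto
      finally show ?case by simp
    qed
  qed
  have "(\<lambda>n. y n + R n) \<longlonglongrightarrow> 0"
  proof (rule tendstoI)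
    fix d :: real assume "0 < d"
    show "\<forall>\<^sub>F n in sequentially. dist (y n + R n) 0 < d"
      using less[OF disjI1[OF refl] \<open>0 < d\<close>] less[OF disjI2[OF refl] \<open>0 < d\<close>]
      by eventually_elim (simp add: dist_real_def abs_less_iff)
  qed
  from tendsto_diff[OF this R0] show ?thesis by simp
qed

text \<open>
  This is the induction along the order from the introduction. For a state that is not visited,
  only raises are controlled, and these come from below; so the induction can run from the minimal
  states upwards, and lowerings by larger states do no harm.
\<close>

lemma monotone_relaxation_upper:
  fixes v h w :: "nat \<Rightarrow> 'x \<Rightarrow> real" and V :: "'x \<Rightarrow> real"
  assumes fin: "finite X"
    and refl: "\<And>s. s \<in> X \<Longrightarrow> le s s"
    and trans: "\<And>r s u. r \<in> X \<Longrightarrow> s \<in> X \<Longrightarrow> u \<in> X \<Longrightarrow> le r s \<Longrightarrow> le s u \<Longrightarrow> le r u"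
    and antisym: "\<And>r s. r \<in> X \<Longrightarrow> s \<in> X \<Longrightarrow> le r s \<Longrightarrow> le s r \<Longrightarrow> r = s"
    and mono: "\<And>r s. r \<in> X \<Longrightarrow> s \<in> X \<Longrightarrow> le r s \<Longrightarrow> V r \<le> V s"
    and a: "\<And>n. a n \<in> {0..1}"
    and x: "\<And>n. x n \<in> X"
    and own: "\<And>n. v (Suc n) (x n) = (1 - a n) * v n (x n) + a n * (h n (x n) + w n (x n))"
    and other: "\<And>n s. s \<in> X \<Longrightarrow> s \<noteq> x n \<Longrightarrow>
      v (Suc n) s \<le> v n s \<or> le (x n) s \<and> v (Suc n) s \<le> max (v n s) (v (Suc n) (x n))"
    and h: "\<And>s. s \<in> X \<Longrightarrow> (\<lambda>n. h n s) \<longlonglongrightarrow> V s"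
    and div: "\<And>s. s \<in> X \<Longrightarrow> \<not> summable (\<lambda>n. a n * of_bool (s = x n))"
    and noise: "\<And>s. s \<in> X \<Longrightarrow> summable (\<lambda>n. a n * of_bool (s = x n) * w n s)"
    and "s \<in> X" "V s < d"
  shows "\<forall>\<^sub>F n in sequentially. v n s < d"
  using \<open>s \<in> X\<close> \<open>V s < d\<close>
proof (induction "card {r \<in> X. le r s}" arbitrary: s d rule: less_induct)
  case less
  note s = \<open>s \<in> X\<close>
  have below: "\<forall>\<^sub>F n in sequentially. v n r < d'" if "r \<in> X" "le r s" "r \<noteq> s" "V s < d'" for r d'
  proof (rule less.hyps)
    have "{q \<in> X. le q r} \<subset> {q \<in> X. le q s}"
      using that s trans antisym refl by blast
    then show "card {q \<in> X. le q r} < card {q \<in> X. le q s}"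
      using fin by (intro psubset_card_mono) auto
    show "V r < d'" using mono[of r s] that s by simp
  qed (use that in auto)
  define b where "b n = a n * of_bool (s = x n)" for n
  \<comment> \<open>The part of the estimate at s that is due to noise. After subtracting it, the steps at s are noise-free.\<close>
  define y where "y = rec_nat 0 (\<lambda>n yn. (1 - b n) * yn + b n * w n s)"
  have y: "y \<longlonglongrightarrow> 0"
  proof (rule relaxed_noise_tendsto_zero)
    show "b n \<in> {0..1}" for n using a[of n] by (auto simp: b_def)
    show "\<not> summable b" "summable (\<lambda>n. b n * w n s)"
      using div[OF s] noise[OF s] by (simp_all add: b_def[abs_def])
    show "y (Suc n) = (1 - b n) * y n + b n * w n s" for n by (simp add: y_def)
  qed
  \<comment> \<open>Four equal margins: one for raises from below and for the observations, one for the noise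
    when a raise is compared with the noise-free part, one to fall below the level, one to add the
    noise back.\<close>
  define \<eta> where "\<eta> = (d - V s) / 4"
  have \<eta>: "\<eta> > 0" "d = V s + 4 * \<eta>" using less.prems by (simp_all add: \<eta>_def field_simps)
  have ev_below: "\<forall>\<^sub>F n in sequentially. \<forall>r\<in>{r\<in>X. le r s \<and> r \<noteq> s}. v (Suc n) r < V s + \<eta>"
    using fin \<eta> below eventually_sequentially_Suc[of "\<lambda>n. v n _ < V s + \<eta>"]
    by (intro eventually_ball_finite) auto
  have ev_y: "\<forall>\<^sub>F n in sequentially. \<bar>y n\<bar> < \<eta>"
    using tendstoD[OF y \<eta>(1)] by (simp add: dist_real_def)
  have ev_h: "\<forall>\<^sub>F n in sequentially. h n s < V s + \<eta>"
    using order_tendstoD(2)[OF h[OF s], of "V s + \<eta>"] \<eta> by simp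
  have "\<forall>\<^sub>F n in sequentially. v n s - y n < V s + 3 * \<eta>"
  proof (rule relaxation_eventually_less[where a = b and c = "V s + 2 * \<eta>"])
    show "b n \<in> {0..1}" for n using a[of n] by (auto simp: b_def)
    show "\<not> summable b" using div[OF s] by (simp add: b_def[abs_def])
    show "\<forall>\<^sub>F n in sequentially. v (Suc n) s - y (Suc n) \<le>
      max (V s + 2 * \<eta>) ((1 - b n) * (v n s - y n) + b n * (V s + 2 * \<eta>))"
      using ev_below ev_y ev_h
    proof eventually_elim
      case (elim n)
      show ?case
      proof (cases "s = x n")
        case True
        have "v (Suc n) s - y (Suc n) = (1 - b n) * (v n s - y n) + b n * h n s"
          using own[of n] True by (simp add: y_def b_def algebra_simps)
        also have "\<dots> \<le> (1 - b n) * (v n s - y n) + b n * (V s + 2 * \<eta>)"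
          using elim a[of n] \<eta> by (intro add_left_mono mult_left_mono) (auto simp: b_def)
        finally show ?thesis by simp
      next
        case False
        then have "b n = 0" "y (Suc n) = y n" by (simp_all add: b_def y_def)
        moreover have "v (Suc n) s \<le> v n s \<or> v (Suc n) s \<le> max (v n s) (V s + \<eta>)"
        proof -
          from other[OF s False] consider "v (Suc n) s \<le> v n s"
            | "le (x n) s" "v (Suc n) s \<le> max (v n s) (v (Suc n) (x n))" by blast
          then show ?thesis
          proof cases
            case 2
            then have "v (Suc n) (x n) < V s + \<eta>" using elim x[of n] False by auto
            then show ?thesis using 2 by linarith
          qed simp
        qed
        ultimately show ?thesis using elim by (auto simp: max_def split: if_splits)
      qed
    qed
  qed (use \<eta> in auto)
  then show ?case
    using ev_y by eventually_elim (use \<eta> in linarith)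
qed

text \<open>
  The scheme is symmetric under negating all values and reversing the order, so the one-sided bound
  gives both halves of the limit.
\<close>

lemma monotone_relaxation_tendsto:
  fixes v h w :: "nat \<Rightarrow> 'x \<Rightarrow> real" and V :: "'x \<Rightarrow> real"
  assumes fin: "finite X"
    and refl: "\<And>s. s \<in> X \<Longrightarrow> le s s"
    and trans: "\<And>r s u. r \<in> X \<Longrightarrow> s \<in> X \<Longrightarrow> u \<in> X \<Longrightarrow> le r s \<Longrightarrow> le s u \<Longrightarrow> le r u"
    and antisym: "\<And>r s. r \<in> X \<Longrightarrow> s \<in> X \<Longrightarrow> le r s \<Longrightarrow> le s r \<Longrightarrow> r = s"
    and mono: "\<And>r s. r \<in> X \<Longrightarrow> s \<in> X \<Longrightarrow> le r s \<Longrightarrow> V r \<le> V s"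
    and a: "\<And>n. a n \<in> {0..1}"
    and x: "\<And>n. x n \<in> X"
    and own: "\<And>n. v (Suc n) (x n) = (1 - a n) * v n (x n) + a n * (h n (x n) + w n (x n))"
    and above: "\<And>n s. s \<in> X \<Longrightarrow> s \<noteq> x n \<Longrightarrow> le (x n) s \<Longrightarrow> v (Suc n) s = max (v (Suc n) (x n)) (v n s)"
    and below: "\<And>n s. s \<in> X \<Longrightarrow> s \<noteq> x n \<Longrightarrow> le s (x n) \<Longrightarrow> v (Suc n) s = min (v (Suc n) (x n)) (v n s)"
    and incomparable: "\<And>n s. s \<in> X \<Longrightarrow> \<not> le s (x n) \<Longrightarrow> \<not> le (x n) s \<Longrightarrow> v (Suc n) s = v n s"
    and h: "\<And>s. s \<in> X \<Longrightarrow> (\<lambda>n. h n s) \<longlonglongrightarrow> V s"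
    and div: "\<And>s. s \<in> X \<Longrightarrow> \<not> summable (\<lambda>n. a n * of_bool (s = x n))"
    and noise: "\<And>s. s \<in> X \<Longrightarrow> summable (\<lambda>n. a n * of_bool (s = x n) * w n s)"
    and "s \<in> X"
  shows "(\<lambda>n. v n s) \<longlonglongrightarrow> V s"
proof (rule order_tendstoI)
  fix d assume "V s < d"
  with fin refl trans antisym mono a x own _ h div noise \<open>s \<in> X\<close>
  show "\<forall>\<^sub>F n in sequentially. v n s < d"
  proof (rule monotone_relaxation_upper)
    fix n r assume "r \<in> X" "r \<noteq> x n"
    then show "v (Suc n) r \<le> v n r \<or> le (x n) r \<and> v (Suc n) r \<le> max (v n r) (v (Suc n) (x n))"
      using above[of r n] below[of r n] incomparable[of r n] by (cases "le r (x n)"; cases "le (x n) r") auto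
  qed
next
  fix d assume d: "d < V s"
  have "\<forall>\<^sub>F n in sequentially. - v n s < - d"
  proof (rule monotone_relaxation_upper[where X = X and le = "\<lambda>r s. le s r" and V = "\<lambda>r. - V r" and a = a
        and x = x and h = "\<lambda>n r. - h n r" and w = "\<lambda>n r. - w n r" and v = "\<lambda>n r. - v n r"])
    fix n r assume "r \<in> X" "r \<noteq> x n"
    then show "- v (Suc n) r \<le> - v n r \<or> le r (x n) \<and> - v (Suc n) r \<le> max (- v n r) (- v (Suc n) (x n))"
      using above[of r n] below[of r n] incomparable[of r n] by (cases "le r (x n)"; cases "le (x n) r") auto
  next
    show "- v (Suc n) (x n) = (1 - a n) * - v n (x n) + a n * (- h n (x n) + - w n (x n))" for n
      using own[of n] by (simp add: algebra_simps)
  next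
    show "summable (\<lambda>n. a n * of_bool (r = x n) * - w n r)" if "r \<in> X" for r
      using summable_minus[OF noise[OF that]] by simp
  next
    show "(\<lambda>n. - h n r) \<longlonglongrightarrow> - V r" if "r \<in> X" for r
      using h[OF that] by (rule tendsto_minus)
  qed (use fin refl antisym mono a x div \<open>s \<in> X\<close> d in \<open>auto intro: trans\<close>)
  then show "\<forall>\<^sub>F n in sequentially. d < v n s" by simp
qed

section \<open>Almost sure convergence of martingale difference series\<close>

text \<open>
  Kolmogorov's argument. Orthogonality makes the second moment of a partial sum the sum of the second
  moments of its terms, and this stays true for the partial sums stopped when they first leave
  \<open>(-\<epsilon>, \<epsilon>)\<close>. Markov's inequality for the stopped sum is then the maximal inequality, and the tails
  of the variance series force the partial sums to be Cauchy.
\<close>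

lemma (in prob_space) AE_summable_orthogonal_increments:
  fixes \<xi> :: "nat \<Rightarrow> 'a \<Rightarrow> real"
  assumes sub: "\<And>n. subalgebra M (F n)" "\<And>n. subalgebra (F (Suc n)) (F n)"
    and meas: "\<And>n. \<xi> n \<in> borel_measurable (F (Suc n))"
    and bound: "\<And>n \<omega>. \<omega> \<in> space M \<Longrightarrow> \<bar>\<xi> n \<omega>\<bar> \<le> B"
    and orth: "\<And>n g C. g \<in> borel_measurable (F n) \<Longrightarrow> (\<And>\<omega>. \<omega> \<in> space M \<Longrightarrow> \<bar>g \<omega>\<bar> \<le> C) \<Longrightarrow>
      expectation (\<lambda>\<omega>. g \<omega> * \<xi> n \<omega>) = 0"
    and var: "summable (\<lambda>n. expectation (\<lambda>\<omega>. (\<xi> n \<omega>)\<^sup>2))"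
  shows "AE \<omega> in M. summable (\<lambda>n. \<xi> n \<omega>)"
proof -
  have spc[simp]: "space (F n) = space M" for n
    using sub(1) by (auto simp: subalgebra_def)
  have up: "f \<in> borel_measurable (F k)" if "f \<in> borel_measurable (F n)" "n \<le> k" for f :: "'a \<Rightarrow> real" and n k
    using that(2,1) by (induction rule: dec_induct) (auto intro: measurable_from_subalg[OF sub(2)])
  have toM: "f \<in> borel_measurable M" if "f \<in> borel_measurable (F n)" for f :: "'a \<Rightarrow> real" and n
    using that by (rule measurable_from_subalg[OF sub(1)])
  have meas': "\<xi> n \<in> borel_measurable (F k)" if "n < k" for n k
    using meas up that Suc_leI by blast
  have [measurable]: "\<xi> n \<in> borel_measurable M" for n
    using meas toM by blast
  define \<sigma> where "\<sigma> n = expectation (\<lambda>\<omega>. (\<xi> n \<omega>)\<^sup>2)" for n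
  have \<sigma>0: "0 \<le> \<sigma> n" for n by (simp add: \<sigma>_def)
  define T where "T m k \<omega> = (\<Sum>i<k. \<xi> (m + i) \<omega>)" for m k \<omega>
  have Tmeas: "T m k \<in> borel_measurable (F (m + k))" for m k
    unfolding T_def[abs_def] by (intro borel_measurable_sum meas') auto
  have TM[measurable]: "T m k \<in> borel_measurable M" for m k
    using Tmeas toM by blast

  have maximal: "prob {\<omega> \<in> space M. \<exists>j\<le>k. \<epsilon> \<le> \<bar>T m j \<omega>\<bar>} \<le> (\<Sum>i<k. \<sigma> (m + i)) / \<epsilon>\<^sup>2"
    if "0 < \<epsilon>" for m k \<epsilon>
  proof -
    \<comment> \<open>\<open>on j\<close>: not yet stopped after j terms; \<open>Y\<close>: the partial sums stopped at the first exit.\<close>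
    define on where "on j \<omega> \<longleftrightarrow> (\<forall>i\<le>j. \<bar>T m i \<omega>\<bar> < \<epsilon>)" for j \<omega>
    define \<eta> where "\<eta> j \<omega> = of_bool (on j \<omega>) * \<xi> (m + j) \<omega>" for j \<omega>
    define Y where "Y j \<omega> = (\<Sum>i<j. \<eta> i \<omega>)" for j \<omega>
    have on_meas: "(\<lambda>\<omega>. of_bool (on j \<omega>) :: real) \<in> borel_measurable (F (m + j))" for j
    proof -
      have [measurable]: "T m i \<in> borel_measurable (F (m + j))" if "i \<in> {..j}" for i
        using up[OF Tmeas[of m i], of "m + j"] that by simp
      have "Measurable.pred (F (m + j)) (\<lambda>\<omega>. \<forall>i\<in>{..j}. \<bar>T m i \<omega>\<bar> < \<epsilon>)"
        by measurable
      then have [measurable]: "Measurable.pred (F (m + j)) (on j)"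
        by (simp add: on_def[abs_def] atMost_def)
      show ?thesis by measurable
    qed
    have \<eta>_meas: "\<eta> j \<in> borel_measurable (F (Suc (m + j)))" for j
      unfolding \<eta>_def using up[OF on_meas[of j]] meas by (intro borel_measurable_times) auto
    have Y_meas: "Y j \<in> borel_measurable (F (m + j))" for j
      unfolding Y_def[abs_def] by (intro borel_measurable_sum up[OF \<eta>_meas]) auto
    have [measurable]: "\<eta> j \<in> borel_measurable M" "Y j \<in> borel_measurable M"
        "(\<lambda>\<omega>. of_bool (on j \<omega>) :: real) \<in> borel_measurable M" for j
      using \<eta>_meas Y_meas on_meas toM by blast+
    have \<eta>_le: "\<bar>\<eta> j \<omega>\<bar> \<le> B" if "\<omega> \<in> space M" for j \<omega>
      using bound[OF that, of "m + j"] by (auto simp: \<eta>_def)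
    have Y_le: "\<bar>Y j \<omega>\<bar> \<le> real j * B" if "\<omega> \<in> space M" for j \<omega>
      using order_trans[OF sum_abs sum_mono[of "{..<j}" "\<lambda>i. \<bar>\<eta> i \<omega>\<bar>" "\<lambda>_. B"]] \<eta>_le[OF that]
      by (simp add: Y_def)
    have product_integrable: "integrable M (\<lambda>\<omega>. f \<omega> * g \<omega>)"
      if f: "f \<in> borel_measurable M" "\<And>\<omega>. \<omega> \<in> space M \<Longrightarrow> \<bar>f \<omega>\<bar> \<le> K"
        and g: "g \<in> borel_measurable M" "\<And>\<omega>. \<omega> \<in> space M \<Longrightarrow> \<bar>g \<omega>\<bar> \<le> L"
      for f g :: "'a \<Rightarrow> real" and K L
    proof (rule integrable_const_bound)
      show "AE \<omega> in M. norm (f \<omega> * g \<omega>) \<le> K * L"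
      proof (rule AE_I2)
        fix \<omega> assume "\<omega> \<in> space M"
        then show "norm (f \<omega> * g \<omega>) \<le> K * L"
          using f(2)[of \<omega>] g(2)[of \<omega>] abs_ge_zero[of "f \<omega>"] unfolding real_norm_def abs_mult
          by (intro mult_mono) linarith+
      qed
      show "(\<lambda>\<omega>. f \<omega> * g \<omega>) \<in> borel_measurable M"
        using f g by (intro borel_measurable_times)
    qed
    have iY: "integrable M (\<lambda>\<omega>. (Y j \<omega>)\<^sup>2)" for j
      unfolding power2_eq_square using Y_le by (intro product_integrable) auto
    have sq: "expectation (\<lambda>\<omega>. (Y j \<omega>)\<^sup>2) \<le> (\<Sum>i<j. \<sigma> (m + i))" for j
    proof (induction j)
      case (Suc j)
      have i\<eta>: "integrable M (\<lambda>\<omega>. (\<eta> j \<omega>)\<^sup>2)"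
        unfolding power2_eq_square using \<eta>_le by (intro product_integrable) auto
      have i\<xi>: "integrable M (\<lambda>\<omega>. (\<xi> (m + j) \<omega>)\<^sup>2)"
        unfolding power2_eq_square using bound by (intro product_integrable) auto
      have iY\<eta>: "integrable M (\<lambda>\<omega>. Y j \<omega> * \<eta> j \<omega>)"
        using Y_le \<eta>_le by (intro product_integrable) auto
      have "expectation (\<lambda>\<omega>. (Y j \<omega> * of_bool (on j \<omega>)) * \<xi> (m + j) \<omega>) = 0"
      proof (rule orth)
        show "(\<lambda>\<omega>. Y j \<omega> * of_bool (on j \<omega>)) \<in> borel_measurable (F (m + j))"
          using Y_meas on_meas by (intro borel_measurable_times) auto
        show "\<bar>Y j \<omega> * of_bool (on j \<omega>)\<bar> \<le> real j * B" if "\<omega> \<in> space M" for \<omega>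
          using Y_le[OF that, of j] by auto
      qed
      then have cross: "expectation (\<lambda>\<omega>. Y j \<omega> * \<eta> j \<omega>) = 0"
        by (simp add: \<eta>_def mult.assoc)
      have "expectation (\<lambda>\<omega>. (Y (Suc j) \<omega>)\<^sup>2) =
          expectation (\<lambda>\<omega>. (Y j \<omega>)\<^sup>2 + (\<eta> j \<omega>)\<^sup>2 + 2 * (Y j \<omega> * \<eta> j \<omega>))"
        by (simp add: Y_def power2_sum mult.assoc)
      also have "\<dots> = expectation (\<lambda>\<omega>. (Y j \<omega>)\<^sup>2) + expectation (\<lambda>\<omega>. (\<eta> j \<omega>)\<^sup>2)"
        using iY i\<eta> iY\<eta> cross by simp
      also have "expectation (\<lambda>\<omega>. (\<eta> j \<omega>)\<^sup>2) \<le> \<sigma> (m + j)"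
        unfolding \<sigma>_def using i\<eta> i\<xi> by (intro integral_mono) (auto simp: \<eta>_def)
      finally show ?case using Suc.IH by simp
    qed (simp add: Y_def)
    have stopped: "Y k \<omega> = T m j \<omega>" if "j \<le> k" "\<epsilon> \<le> \<bar>T m j \<omega>\<bar>" "\<And>i. i < j \<Longrightarrow> \<bar>T m i \<omega>\<bar> < \<epsilon>" for j \<omega>
    proof -
      have "Y k \<omega> = (\<Sum>i<j. \<eta> i \<omega>)"
        unfolding Y_def using that
        by (intro sum.mono_neutral_right) (auto simp: \<eta>_def on_def not_less not_le)
      also have "\<dots> = T m j \<omega>"
        unfolding T_def using that by (intro sum.cong) (auto simp: \<eta>_def on_def)
      finally show ?thesis .
    qed
    have "{\<omega> \<in> space M. \<exists>j\<le>k. \<epsilon> \<le> \<bar>T m j \<omega>\<bar>} \<subseteq> {\<omega> \<in> space M. \<epsilon>\<^sup>2 \<le> (Y k \<omega>)\<^sup>2}"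
    proof safe
      fix \<omega> j assume "j \<le> k" "\<epsilon> \<le> \<bar>T m j \<omega>\<bar>"
      define i where "i = (LEAST i. \<epsilon> \<le> \<bar>T m i \<omega>\<bar>)"
      have i: "\<epsilon> \<le> \<bar>T m i \<omega>\<bar>"
        unfolding i_def using \<open>\<epsilon> \<le> \<bar>T m j \<omega>\<bar>\<close> by (rule LeastI)
      have "i \<le> j"
        unfolding i_def using \<open>\<epsilon> \<le> \<bar>T m j \<omega>\<bar>\<close> by (rule Least_le)
      have "\<bar>T m i' \<omega>\<bar> < \<epsilon>" if "i' < i" for i'
        using not_less_Least[of i' "\<lambda>i. \<epsilon> \<le> \<bar>T m i \<omega>\<bar>"] that by (simp add: i_def)
      then have "Y k \<omega> = T m i \<omega>"
        using i \<open>i \<le> j\<close> \<open>j \<le> k\<close> by (intro stopped) auto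
      then show "\<epsilon>\<^sup>2 \<le> (Y k \<omega>)\<^sup>2"
        using i \<open>0 < \<epsilon>\<close> by (metis abs_le_square_iff abs_of_pos)
    qed
    then have "prob {\<omega> \<in> space M. \<exists>j\<le>k. \<epsilon> \<le> \<bar>T m j \<omega>\<bar>} \<le> prob {\<omega> \<in> space M. \<epsilon>\<^sup>2 \<le> (Y k \<omega>)\<^sup>2}"
      by (intro finite_measure_mono) measurable
    also have "\<dots> \<le> expectation (\<lambda>\<omega>. (Y k \<omega>)\<^sup>2) / \<epsilon>\<^sup>2"
      using \<open>0 < \<epsilon>\<close> iY by (intro integral_Markov_inequality_measure[where A = "{}"]) auto
    also have "\<dots> \<le> (\<Sum>i<k. \<sigma> (m + i)) / \<epsilon>\<^sup>2"
      using sq by (intro divide_right_mono) auto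
    finally show ?thesis .
  qed

  have tail: "prob {\<omega> \<in> space M. \<exists>j. \<epsilon> \<le> \<bar>T m j \<omega>\<bar>} \<le> (\<Sum>i. \<sigma> (i + m)) / \<epsilon>\<^sup>2"
    if "0 < \<epsilon>" for m \<epsilon>
  proof -
    have "(\<lambda>k. prob {\<omega> \<in> space M. \<exists>j\<le>k. \<epsilon> \<le> \<bar>T m j \<omega>\<bar>}) \<longlonglongrightarrow>
        prob (\<Union>k. {\<omega> \<in> space M. \<exists>j\<le>k. \<epsilon> \<le> \<bar>T m j \<omega>\<bar>})"
      by (rule finite_Lim_measure_incseq) (auto simp: incseq_def intro: order_trans)
    moreover have "(\<Union>k. {\<omega> \<in> space M. \<exists>j\<le>k. \<epsilon> \<le> \<bar>T m j \<omega>\<bar>}) = {\<omega> \<in> space M. \<exists>j. \<epsilon> \<le> \<bar>T m j \<omega>\<bar>}"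
      by auto
    moreover have "prob {\<omega> \<in> space M. \<exists>j\<le>k. \<epsilon> \<le> \<bar>T m j \<omega>\<bar>} \<le> (\<Sum>i. \<sigma> (i + m)) / \<epsilon>\<^sup>2" for k
    proof (rule order_trans[OF maximal[OF that] divide_right_mono])
      have "(\<Sum>i<k. \<sigma> (i + m)) \<le> (\<Sum>i. \<sigma> (i + m))"
        using var \<sigma>0 by (intro sum_le_suminf summable_ignore_initial_segment) (auto simp: \<sigma>_def[abs_def])
      then show "(\<Sum>i<k. \<sigma> (m + i)) \<le> (\<Sum>i. \<sigma> (i + m))" by (simp add: add.commute)
    qed simp
    ultimately show ?thesis
      by (metis (no_types, lifting) LIMSEQ_le_const2)
  qed

  have small: "AE \<omega> in M. \<exists>m. \<forall>j. \<bar>T m j \<omega>\<bar> < \<epsilon>" if "0 < \<epsilon>" for \<epsilon>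
  proof -
    let ?bad = "{\<omega> \<in> space M. \<forall>m. \<exists>j. \<epsilon> \<le> \<bar>T m j \<omega>\<bar>}"
    have "prob ?bad \<le> (\<Sum>i. \<sigma> (i + m)) / \<epsilon>\<^sup>2" for m
      by (rule order_trans[OF finite_measure_mono tail[OF that, of m]]) auto
    moreover have "(\<lambda>m. (\<Sum>i. \<sigma> (i + m)) / \<epsilon>\<^sup>2) \<longlonglongrightarrow> 0 / \<epsilon>\<^sup>2"
      using var \<open>0 < \<epsilon>\<close> by (intro tendsto_divide suminf_exist_split2) (auto simp: \<sigma>_def[abs_def])
    ultimately have "prob ?bad \<le> 0"
      by (intro LIMSEQ_le_const[of _ 0]) auto
    then have "prob ?bad = 0"
      by (simp add: measure_le_0_iff)
    then have "AE \<omega> in M. \<omega> \<notin> ?bad"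
      by (subst (asm) prob_eq_0) auto
    then show ?thesis
      by (rule AE_mp) (intro AE_I2, auto simp: not_le)
  qed
  have "AE \<omega> in M. \<forall>r. \<exists>m. \<forall>j. \<bar>T m j \<omega>\<bar> < inverse (real (Suc r))"
    unfolding AE_all_countable by (intro allI small) simp
  then show ?thesis
  proof eventually_elim
    case (elim \<omega>)
    have "\<exists>N. \<forall>m\<ge>N. \<forall>n. norm (sum (\<lambda>n. \<xi> n \<omega>) {m..<n}) < e" if "0 < e" for e
    proof -
      obtain r where r: "inverse (real (Suc r)) < e / 2"
        using reals_Archimedean[of "e / 2"] \<open>0 < e\<close> by auto
      obtain N where N: "\<And>j. \<bar>T N j \<omega>\<bar> < inverse (real (Suc r))"
        using elim by blast
      have split: "sum (\<lambda>n. \<xi> n \<omega>) {m..<n} = T N (n - N) \<omega> - T N (m - N) \<omega>" if "N \<le> m" "m \<le> n" for m n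
      proof -
        have "T N (k - N) \<omega> = sum (\<lambda>n. \<xi> n \<omega>) {N..<k}" if "N \<le> k" for k
          unfolding T_def using that sum.shift_bounds_nat_ivl[of "\<lambda>n. \<xi> n \<omega>" 0 N "k - N"]
          by (simp add: atLeast0LessThan add.commute)
        then show ?thesis using that by (simp add: sum_diff_nat_ivl)
      qed
      show ?thesis
      proof (intro exI[of _ N] allI impI)
        fix m n assume "N \<le> m"
        show "norm (sum (\<lambda>n. \<xi> n \<omega>) {m..<n}) < e"
        proof (cases "m \<le> n")
          case True
          show ?thesis
            using split[OF \<open>N \<le> m\<close> True] N[of "n - N"] N[of "m - N"] r unfolding real_norm_def by linarith
        qed (use \<open>0 < e\<close> in simp)
      qed
    qed
    then show ?case by (simp add: summable_Cauchy)
  qed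
qed

text \<open>
  Localization. Up to the last time at which the sum of squares Q is at most c, the sum of squares is
  at most \<open>c + B\<^sup>2\<close>: only the final term can overshoot. So the series cut off at this time has a
  summable variance and converges; almost every path agrees with its cut-off series for c large enough.
\<close>

lemma (in prob_space) AE_summable_martingale_differences:
  fixes \<xi> :: "nat \<Rightarrow> 'a \<Rightarrow> real"
  assumes sub: "\<And>n. subalgebra M (F n)" "\<And>n. subalgebra (F (Suc n)) (F n)"
    and meas: "\<And>n. \<xi> n \<in> borel_measurable (F (Suc n))"
    and bound: "\<And>n. AE \<omega> in M. \<bar>\<xi> n \<omega>\<bar> \<le> B"
    and cond: "\<And>n. AE \<omega> in M. real_cond_exp M (F n) (\<xi> n) \<omega> = 0"
    and var: "AE \<omega> in M. summable (\<lambda>n. (\<xi> n \<omega>)\<^sup>2)"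
  shows "AE \<omega> in M. summable (\<lambda>n. \<xi> n \<omega>)"
proof -
  have spc[simp]: "space (F n) = space M" for n
    using sub(1) by (auto simp: subalgebra_def)
  have toM: "f \<in> borel_measurable M" if "f \<in> borel_measurable (F n)" for f :: "'a \<Rightarrow> real" and n
    using that by (rule measurable_from_subalg[OF sub(1)])
  have meas': "\<xi> n \<in> borel_measurable (F k)" if "n < k" for n k
    using Suc_leI[OF that] meas[of n]
    by (induction rule: dec_induct) (auto intro: measurable_from_subalg[OF sub(2)])
  have [measurable]: "\<xi> n \<in> borel_measurable M" for n
    using meas toM by blast
  define Q where "Q n \<omega> = (\<Sum>k<n. (\<xi> k \<omega>)\<^sup>2)" for n \<omega>
  have Q_meas[measurable]: "Q n \<in> borel_measurable (F n)" for n
    unfolding Q_def[abs_def] by (intro borel_measurable_sum borel_measurable_power meas') auto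
  have Q_le: "Q n \<omega> \<le> Q (Suc n) \<omega>" for n \<omega> by (simp add: Q_def)
  \<comment> \<open>Q n depends on the terms before n only, so cutting off by it keeps the conditional mean zero. The
    second factor changes the terms on a null set only, and makes the bound hold everywhere.\<close>
  define \<zeta> where "\<zeta> c n \<omega> = of_bool (Q n \<omega> \<le> real c) * of_bool (\<bar>\<xi> n \<omega>\<bar> \<le> B) * \<xi> n \<omega>" for c n \<omega>
  have stop_meas: "(\<lambda>\<omega>. of_bool (Q n \<omega> \<le> real c) :: real) \<in> borel_measurable (F n)" for c n
    by measurable
  have \<zeta>_meas: "\<zeta> c n \<in> borel_measurable (F (Suc n))" for c n
  proof -
    have [measurable]: "Q n \<in> borel_measurable (F (Suc n))" "\<xi> n \<in> borel_measurable (F (Suc n))"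
      using measurable_from_subalg[OF sub(2) Q_meas] meas by auto
    show ?thesis unfolding \<zeta>_def[abs_def] by measurable
  qed
  have [measurable]: "\<zeta> c n \<in> borel_measurable M" for c n
    using \<zeta>_meas toM by blast
  have \<zeta>_le: "\<bar>\<zeta> c n \<omega>\<bar> \<le> \<bar>B\<bar>" for c n \<omega> by (auto simp: \<zeta>_def)
  have \<zeta>_sq: "(\<Sum>k<n. (\<zeta> c k \<omega>)\<^sup>2) \<le> Q n \<omega> \<and> (\<Sum>k<n. (\<zeta> c k \<omega>)\<^sup>2) \<le> real c + B\<^sup>2" for c n \<omega>
  proof (induction n)
    case (Suc n)
    show ?case
    proof (cases "Q n \<omega> \<le> real c")
      case True
      have "(\<zeta> c n \<omega>)\<^sup>2 \<le> (\<xi> n \<omega>)\<^sup>2" "(\<zeta> c n \<omega>)\<^sup>2 \<le> B\<^sup>2"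
        using \<zeta>_le[of c n \<omega>] by (auto simp: \<zeta>_def abs_le_square_iff[symmetric])
      then show ?thesis using Suc.IH True by (auto simp: Q_def)
    next
      case False
      then have "\<zeta> c n \<omega> = 0" by (simp add: \<zeta>_def)
      then show ?thesis using Suc.IH Q_le[of n \<omega>] by auto
    qed
  qed (simp add: Q_def)
  have "AE \<omega> in M. summable (\<lambda>n. \<zeta> c n \<omega>)" for c
  proof (rule AE_summable_orthogonal_increments[where F = F and \<xi> = "\<zeta> c" and B = "\<bar>B\<bar>", OF sub \<zeta>_meas \<zeta>_le])
    fix n and g :: "'a \<Rightarrow> real" and C :: real
    assume g: "g \<in> borel_measurable (F n)" and C: "\<And>\<omega>. \<omega> \<in> space M \<Longrightarrow> \<bar>g \<omega>\<bar> \<le> C"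
    interpret finite_measure_subalgebra M "F n" by standard (rule sub)
    define f where "f \<omega> = g \<omega> * of_bool (Q n \<omega> \<le> real c)" for \<omega>
    have f: "f \<in> borel_measurable (F n)"
      unfolding f_def[abs_def] using g stop_meas by (intro borel_measurable_times) auto
    note [measurable] = toM[OF f] toM[OF g] toM[OF Q_meas]
    have int: "integrable M (\<lambda>\<omega>. f \<omega> * \<xi> n \<omega>)"
    proof (rule integrable_const_bound)
      show "AE \<omega> in M. norm (f \<omega> * \<xi> n \<omega>) \<le> \<bar>C\<bar> * B"
        using bound[of n] AE_space
      proof eventually_elim
        case (elim \<omega>)
        have "\<bar>f \<omega>\<bar> \<le> \<bar>C\<bar>" using C[of \<omega>] elim by (auto simp: f_def)
        with elim show ?case unfolding real_norm_def abs_mult by (intro mult_mono) auto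
      qed
    qed measurable
    have "expectation (\<lambda>\<omega>. g \<omega> * \<zeta> c n \<omega>) = expectation (\<lambda>\<omega>. f \<omega> * \<xi> n \<omega>)"
    proof (rule integral_cong_AE)
      show "AE \<omega> in M. g \<omega> * \<zeta> c n \<omega> = f \<omega> * \<xi> n \<omega>"
        using bound[of n] by eventually_elim (simp add: \<zeta>_def f_def)
    qed measurable
    also have "\<dots> = expectation (\<lambda>\<omega>. f \<omega> * real_cond_exp M (F n) (\<xi> n) \<omega>)"
      using real_cond_exp_intg(2)[OF int f] by simp
    also have "\<dots> = expectation (\<lambda>_. 0)"
      using cond[of n] by (intro integral_cong_AE) auto
    finally show "expectation (\<lambda>\<omega>. g \<omega> * \<zeta> c n \<omega>) = 0" by simp
  next
    have int: "integrable M (\<lambda>\<omega>. (\<zeta> c n \<omega>)\<^sup>2)" for n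
      using \<zeta>_le[of c n] by (intro integrable_const_bound[where B = "B\<^sup>2"]) (auto simp: abs_le_square_iff[symmetric])
    show "summable (\<lambda>n. expectation (\<lambda>\<omega>. (\<zeta> c n \<omega>)\<^sup>2))"
    proof (rule summableI_nonneg_bounded)
      fix n
      have "(\<Sum>k<n. expectation (\<lambda>\<omega>. (\<zeta> c k \<omega>)\<^sup>2)) = expectation (\<lambda>\<omega>. \<Sum>k<n. (\<zeta> c k \<omega>)\<^sup>2)"
        using int by simp
      also have "\<dots> \<le> expectation (\<lambda>_. real c + B\<^sup>2)"
        using \<zeta>_sq int by (intro integral_mono) auto
      finally show "(\<Sum>k<n. expectation (\<lambda>\<omega>. (\<zeta> c k \<omega>)\<^sup>2)) \<le> real c + B\<^sup>2"
        by (simp add: prob_space)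
    qed simp
  qed
  then have "AE \<omega> in M. \<forall>c. summable (\<lambda>n. \<zeta> c n \<omega>)"
    by (simp add: AE_all_countable)
  moreover have "AE \<omega> in M. \<forall>n. \<bar>\<xi> n \<omega>\<bar> \<le> B"
    using bound by (simp add: AE_all_countable)
  ultimately show ?thesis
    using var
  proof eventually_elim
    case (elim \<omega>)
    obtain c where c: "(\<Sum>n. (\<xi> n \<omega>)\<^sup>2) \<le> real c" using real_arch_simple by blast
    have "Q n \<omega> \<le> real c" for n
      using sum_le_suminf[OF elim(3), of "{..<n}"] c by (simp add: Q_def)
    then have "(\<lambda>n. \<zeta> c n \<omega>) = (\<lambda>n. \<xi> n \<omega>)"
      using elim(2) by (simp add: \<zeta>_def)
    then show ?case using spec[OF elim(1), of c] by simp
  qed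
qed

text \<open>
  Conditional independence of events is lifted to the integrable function f. On every B in F, weighting the
  probability by the indicator of V or by the conditional probability of V gives f the same
  distribution, hence the same mean; the second mean vanishes since its weight is F-measurable.
\<close>

lemma (in prob_space) cond_exp_indicator_times_zero:
  fixes f :: "'a \<Rightarrow> real"
  assumes sub: "subalgebra M F" and [measurable]: "V \<in> sets M"
    and int: "integrable M f"
    and indep: "\<And>A. A \<in> sets borel \<Longrightarrow> AE \<omega> in M.
      real_cond_exp M F (indicator (V \<inter> {\<omega> \<in> space M. f \<omega> \<in> A})) \<omega> =
      real_cond_exp M F (indicator V) \<omega> * real_cond_exp M F (indicator {\<omega> \<in> space M. f \<omega> \<in> A}) \<omega>"
    and zero: "AE \<omega> in M. real_cond_exp M F f \<omega> = 0"
  shows "AE \<omega> in M. real_cond_exp M F (\<lambda>\<omega>. indicator V \<omega> * f \<omega>) \<omega> = 0"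
proof -
  interpret finite_measure_subalgebra M F by standard (rule sub)
  have [measurable]: "f \<in> borel_measurable M" using int by simp
  have fin: "integrable M (indicator A :: 'a \<Rightarrow> real)" if "A \<in> sets M" for A
    using that by (simp add: integrable_indicator_iff emeasure_eq_measure)
  \<comment> \<open>A version of the conditional probability of V with values in [0, 1] everywhere, so that it is a
    density.\<close>
  define p where "p \<omega> = max 0 (min 1 (real_cond_exp M F (indicator V) \<omega>))" for \<omega>
  have p_F: "p \<in> borel_measurable F" unfolding p_def[abs_def] by measurable
  note [measurable] = measurable_from_subalg[OF sub p_F]
  have p01: "0 \<le> p \<omega>" "p \<omega> \<le> 1" for \<omega> by (auto simp: p_def)
  have p_eq: "AE \<omega> in M. real_cond_exp M F (indicator V) \<omega> = p \<omega>"
  proof -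
    have "AE \<omega> in M. 0 \<le> real_cond_exp M F (indicator V) \<omega>"
      by (rule real_cond_exp_ge_c) (auto simp: fin)
    moreover have "AE \<omega> in M. real_cond_exp M F (indicator V) \<omega> \<le> 1"
      by (rule real_cond_exp_le_c) (auto simp: fin indicator_def)
    ultimately show ?thesis by eventually_elim (simp add: p_def)
  qed
  have "(\<integral>\<omega>\<in>B. indicator V \<omega> * f \<omega> \<partial>M) = (\<integral>\<omega>\<in>B. 0 \<partial>M)" if B: "B \<in> sets F" for B
  proof -
    have BM[measurable]: "B \<in> sets M" using B sub by (auto simp: subalgebra_def)
    have Bp: "(\<lambda>\<omega>. indicator B \<omega> * p \<omega>) \<in> borel_measurable F"
      using B p_F by measurable
    have key: "(\<integral>\<omega>. indicator B \<omega> * indicator V \<omega> * indicator {\<omega> \<in> space M. f \<omega> \<in> A} \<omega> \<partial>M) =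
        (\<integral>\<omega>. indicator B \<omega> * p \<omega> * indicator {\<omega> \<in> space M. f \<omega> \<in> A} \<omega> \<partial>M :: real)"
      if [measurable]: "A \<in> sets borel" for A
    proof -
      let ?f = "{\<omega> \<in> space M. f \<omega> \<in> A}"
      have "(\<integral>\<omega>. indicator B \<omega> * indicator V \<omega> * indicator ?f \<omega> \<partial>M) =
          (\<integral>\<omega>. indicator B \<omega> * indicator (V \<inter> ?f) \<omega> \<partial>M :: real)"
        by (intro Bochner_Integration.integral_cong) (auto simp: indicator_def)
      also have "\<dots> = (\<integral>\<omega>. indicator B \<omega> * real_cond_exp M F (indicator (V \<inter> ?f)) \<omega> \<partial>M)"
        using B integrable_mult_indicator[OF BM, of "indicator (V \<inter> ?f) :: 'a \<Rightarrow> real"]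
        by (intro real_cond_exp_intg(2)[symmetric]) (auto simp: fin)
      also have "\<dots> = (\<integral>\<omega>. (indicator B \<omega> * p \<omega>) * real_cond_exp M F (indicator ?f) \<omega> \<partial>M)"
      proof (rule integral_cong_AE)
        show "AE \<omega> in M. indicator B \<omega> * real_cond_exp M F (indicator (V \<inter> ?f)) \<omega> =
            (indicator B \<omega> * p \<omega>) * real_cond_exp M F (indicator ?f) \<omega>"
          using indep[OF that] p_eq by eventually_elim simp
      qed measurable
      also have "\<dots> = (\<integral>\<omega>. (indicator B \<omega> * p \<omega>) * indicator ?f \<omega> \<partial>M)"
      proof (rule real_cond_exp_intg(2)[OF _ Bp])
        show "integrable M (\<lambda>\<omega>. indicator B \<omega> * p \<omega> * indicator ?f \<omega>)"
          using p01 by (intro integrable_const_bound[where B = 1]) (auto simp: indicator_def)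
      qed measurable
      finally show ?thesis .
    qed
    let ?\<mu> = "\<lambda>g. distr (density M (\<lambda>\<omega>. ennreal (indicator B \<omega> * g \<omega>))) borel f"
    have em: "emeasure (?\<mu> g) A = ennreal (\<integral>\<omega>. indicator B \<omega> * g \<omega> * indicator {\<omega> \<in> space M. f \<omega> \<in> A} \<omega> \<partial>M)"
      if [measurable]: "g \<in> borel_measurable M" "A \<in> sets borel" and g: "\<And>\<omega>. 0 \<le> g \<omega>" "\<And>\<omega>. g \<omega> \<le> 1"
      for g :: "'a \<Rightarrow> real" and A
    proof -
      have "emeasure (?\<mu> g) A = (\<integral>\<^sup>+\<omega>. ennreal (indicator B \<omega> * g \<omega>) * indicator (f -` A \<inter> space M) \<omega> \<partial>M)"
        by (simp add: emeasure_distr emeasure_density)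
      also have "\<dots> = (\<integral>\<^sup>+\<omega>. ennreal (indicator B \<omega> * g \<omega> * indicator {\<omega> \<in> space M. f \<omega> \<in> A} \<omega>) \<partial>M)"
        by (intro nn_integral_cong) (auto simp: indicator_def)
      also have "\<dots> = ennreal (\<integral>\<omega>. indicator B \<omega> * g \<omega> * indicator {\<omega> \<in> space M. f \<omega> \<in> A} \<omega> \<partial>M)"
        using g by (intro nn_integral_eq_integral integrable_const_bound[where B = 1])
          (auto simp: indicator_def)
      finally show ?thesis .
    qed
    have "?\<mu> (indicator V) = ?\<mu> p"
      using key p01 by (intro measure_eqI) (simp_all add: em indicator_def[of V])
    then have "(\<integral>y. y \<partial>?\<mu> (indicator V)) = (\<integral>y. y \<partial>?\<mu> p)" by simp
    then have "(\<integral>\<omega>. (indicator B \<omega> * indicator V \<omega>) * f \<omega> \<partial>M) = (\<integral>\<omega>. (indicator B \<omega> * p \<omega>) * f \<omega> \<partial>M)"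
      using p01 by (simp add: integral_distr integral_density)
    also have "\<dots> = (\<integral>\<omega>. (indicator B \<omega> * p \<omega>) * real_cond_exp M F f \<omega> \<partial>M)"
    proof (rule real_cond_exp_intg(2)[symmetric, OF _ Bp])
      show "integrable M (\<lambda>\<omega>. indicator B \<omega> * p \<omega> * f \<omega>)"
        using int p01 by (intro Bochner_Integration.integrable_bound[OF int])
          (auto simp: indicator_def abs_mult intro!: mult_left_le_one_le)
    qed measurable
    also have "\<dots> = (\<integral>\<omega>. 0 \<partial>M)"
      using zero by (intro integral_cong_AE) auto
    finally show ?thesis
      by (simp add: set_lebesgue_integral_def mult.assoc)
  qed
  then show ?thesis
    using integrable_mult_indicator[OF \<open>V \<in> sets M\<close> int]
    by (intro real_cond_exp_charact) auto
qed

section \<open>Transitions and expectations of the bidding model\<close>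

lemma states_members:
  "(r, l, b, p) \<in> states D \<longleftrightarrow> r \<le> Rmax D \<and> l \<le> Lmax D \<and> b \<in> bids D \<and> p \<in> price_states D"
  by (simp add: states_def)

lemma post_states_members:
  "(r, l, b1, b2, p) \<in> post_states D \<longleftrightarrow>
     r \<le> Rmax D \<and> l \<le> Lmax D \<and> b1 \<in> bids D \<and> b2 \<in> bids D \<and> p \<in> price_states D"
  by (simp add: post_states_def)

lemma finite_states:
  assumes "bidding_problem D"
  shows "finite (states D)" "finite (post_states D)"
  using assms by (auto simp: bidding_problem_def states_def post_states_def)

lemma post_le_refl: "post_le x x"
  by (auto simp: post_le_def bid_le_def split: prod.split)

lemma post_le_trans: "post_le x y \<Longrightarrow> post_le y z \<Longrightarrow> post_le x z"
  by (auto simp: post_le_def bid_le_def split: prod.splits)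

lemma post_le_antisym: "post_le x y \<Longrightarrow> post_le y x \<Longrightarrow> x = y"
  by (auto simp: post_le_def bid_le_def prod_eq_iff split: prod.splits)

lemma to_post_in_post_states: "s \<in> states D \<Longrightarrow> b \<in> bids D \<Longrightarrow> to_post s b \<in> post_states D"
  by (cases s) (simp add: states_members post_states_members)

lemma q_at_antimono: "bid_le b b' \<Longrightarrow> q_at P b' m \<le> q_at P b m"
  by (auto simp: q_at_def bid_le_def)

lemma d_at_antimono: "bid_le b b' \<Longrightarrow> d_at P b' m \<le> d_at P b m"
  by (auto simp: d_at_def bid_le_def)

lemma gR_step_mono:
  "r \<le> r' \<Longrightarrow> (\<And>i. x' i \<le> x i) \<Longrightarrow> gR_step D m r x \<le> gR_step D m r' x'"
proof (induction m)
  case (Suc m)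
  have "gR_step D m r x \<le> gR_step D m r' x'" "x' (Suc m) \<le> x (Suc m)"
    using Suc by auto
  then show ?case by (auto intro!: nat_mono)
qed simp

lemma gL_step_mono:
  "l \<le> l' \<Longrightarrow> (\<And>i. y' i \<le> y i) \<Longrightarrow> gL_step m l y \<le> gL_step m l' y'"
proof (induction m)
  case (Suc m)
  have "gL_step m l y \<le> gL_step m l' y'" "y' (Suc m) \<le> y (Suc m)"
    using Suc by auto
  then show ?case by (auto intro!: nat_mono)
qed simp

lemma gL_step_le: "gL_step m l (d_at P b) \<le> l"
  by (induction m) (auto simp: d_at_def)

lemma gR_le: "1 \<le> settlements D \<Longrightarrow> gR D r P b \<le> Rmax D"
  by (cases "settlements D") (auto simp: gR_def)

lemma gL_le: "gL D l P b \<le> l"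
  by (simp add: gL_def gL_step_le)

lemma next_state_in_states:
  assumes "bidding_problem D" "x \<in> post_states D" "p' \<in> price_states D"
  shows "next_state D x P p' \<in> states D"
proof -
  obtain r l b1 b2 p where x: "x = (r, l, b1, b2, p)" by (cases x)
  have "gL D l P b1 \<le> Lmax D"
    using gL_le[of D l P b1] assms(2) by (simp add: x post_states_members)
  moreover have "gR D r P b1 \<le> Rmax D"
    using assms(1) by (intro gR_le) (simp add: bidding_problem_def)
  ultimately show ?thesis
    using assms(2,3) by (simp add: x states_members post_states_members)
qed

lemma measurable_q_at:
  assumes "m \<in> {1..settlements D}"
  shows "(\<lambda>P. q_at P b m) \<in> measurable (price_space D) (count_space UNIV)"
proof -
  have [measurable]: "(\<lambda>P. P m) \<in> borel_measurable (price_space D)"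
    unfolding price_space_def using assms by (rule measurable_component_singleton)
  show ?thesis unfolding q_at_def by measurable
qed

lemma measurable_d_at:
  assumes "m \<in> {1..settlements D}"
  shows "(\<lambda>P. d_at P b m) \<in> measurable (price_space D) (count_space UNIV)"
proof -
  have [measurable]: "(\<lambda>P. P m) \<in> borel_measurable (price_space D)"
    unfolding price_space_def using assms by (rule measurable_component_singleton)
  show ?thesis unfolding d_at_def by measurable
qed

lemma measurable_gR: "(\<lambda>P. gR D r P b) \<in> measurable (price_space D) (count_space UNIV)"
proof -
  have "(\<lambda>P. gR_step D m r (q_at P b)) \<in> measurable (price_space D) (count_space UNIV)"
    if "m \<le> settlements D" for m
    using that
  proof (induction m)
    case (Suc m)
    then have [measurable]: "(\<lambda>P. gR_step D m r (q_at P b)) \<in> measurable (price_space D) (count_space UNIV)"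
      "(\<lambda>P. q_at P b (Suc m)) \<in> measurable (price_space D) (count_space UNIV)"
      by (auto intro: measurable_q_at)
    show ?case unfolding gR_step.simps by measurable
  qed simp
  then show ?thesis by (simp add: gR_def)
qed

lemma measurable_gL: "(\<lambda>P. gL D l P b) \<in> measurable (price_space D) (count_space UNIV)"
proof -
  have "(\<lambda>P. gL_step m l (d_at P b)) \<in> measurable (price_space D) (count_space UNIV)"
    if "m \<le> settlements D" for m
    using that
  proof (induction m)
    case (Suc m)
    then have [measurable]: "(\<lambda>P. gL_step m l (d_at P b)) \<in> measurable (price_space D) (count_space UNIV)"
      "(\<lambda>P. d_at P b (Suc m)) \<in> measurable (price_space D) (count_space UNIV)"
      by (auto intro: measurable_d_at)
    show ?case unfolding gL_step.simps by measurable
  qed simp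
  then show ?thesis by (simp add: gL_def)
qed

lemma price_lawD:
  assumes "bidding_problem D" "t < horizon D" "p \<in> price_states D"
  shows "prob_space (price_law D t p)"
    and "sets (price_law D t p) =
      sets (price_space D \<Otimes>\<^sub>M (count_space (price_states D) \<Otimes>\<^sub>M price_space D))"
    and "AE z in price_law D t p. \<forall>m \<in> {1..settlements D}. 0 \<le> fst z m \<and> 0 \<le> snd (snd z) m"
    and "r \<le> Rmax D \<Longrightarrow> l \<le> Lmax D \<Longrightarrow> b1 \<in> bids D \<Longrightarrow> b \<in> bids D \<Longrightarrow>
      integrable (price_law D t p)
        (\<lambda>z. revenue D (gR D r (fst z) b1) (gL D l (fst z) b1) (snd (snd z)) b)"
proof -
  have law: "prob_space (price_law D t p) \<and>
      sets (price_law D t p) =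
        sets (price_space D \<Otimes>\<^sub>M (count_space (price_states D) \<Otimes>\<^sub>M price_space D)) \<and>
      (AE (P, p', P') in price_law D t p. \<forall>m \<in> {1..settlements D}. 0 \<le> P m \<and> 0 \<le> P' m) \<and>
      (\<forall>r \<le> Rmax D. \<forall>l \<le> Lmax D. \<forall>b1 \<in> bids D. \<forall>b \<in> bids D.
        integrable (price_law D t p)
          (\<lambda>(P, p', P'). revenue D (gR D r P b1) (gL D l P b1) P' b))"
    using assms unfolding bidding_problem_def by blast
  show "prob_space (price_law D t p)"
    and "sets (price_law D t p) =
      sets (price_space D \<Otimes>\<^sub>M (count_space (price_states D) \<Otimes>\<^sub>M price_space D))"
    using law by blast+
  show "AE z in price_law D t p. \<forall>m \<in> {1..settlements D}. 0 \<le> fst z m \<and> 0 \<le> snd (snd z) m"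
    using law unfolding case_prod_unfold by blast
  show "integrable (price_law D t p)
        (\<lambda>z. revenue D (gR D r (fst z) b1) (gL D l (fst z) b1) (snd (snd z)) b)"
    if "r \<le> Rmax D" "l \<le> Lmax D" "b1 \<in> bids D" "b \<in> bids D"
    using law that unfolding case_prod_unfold by blast
qed

lemma price_law_space:
  assumes "bidding_problem D" "t < horizon D" "p \<in> price_states D" "z \<in> space (price_law D t p)"
  shows "fst (snd z) \<in> price_states D"
  using assms(4) unfolding sets_eq_imp_space_eq[OF price_lawD(2)[OF assms(1-3)]]
  by (simp add: space_pair_measure mem_Times_iff)

lemma expect_next_eq:
  "expect_next D t f (r, l, b1, b2, p) =
     (\<integral>z. f (next_state D (r, l, b1, b2, p) (fst z) (fst (snd z))) \<partial>price_law D t p)"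
  by (simp add: expect_next_def case_prod_unfold)

lemma contribution_eq:
  "contribution D t (r, l, b1, p) b =
     (\<integral>z. revenue D (gR D r (fst z) b1) (gL D l (fst z) b1) (snd (snd z)) b \<partial>price_law D t p)"
  by (simp add: case_prod_unfold)

text \<open>
  The next state takes finitely many values and depends measurably on the prices, so any function
  of it is bounded and measurable.
\<close>

lemma integrable_next_state:
  fixes f :: "'p state \<Rightarrow> real"
  assumes D: "bidding_problem D" "t < horizon D" and x: "(r, l, b1, b2, p) \<in> post_states D"
  shows "integrable (price_law D t p) (\<lambda>z. f (next_state D (r, l, b1, b2, p) (fst z) (fst (snd z))))"
proof -
  have p: "p \<in> price_states D" using x by (simp add: post_states_members)
  note law = price_lawD[OF D p]
  interpret prob_space "price_law D t p" by (rule law)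
  let ?L = "price_law D t p"
  note [measurable_cong] = law(2)
  have fstm: "fst \<in> measurable ?L (price_space D)"
    by measurable
  have sndm: "(\<lambda>z. fst (snd z)) \<in> measurable ?L (count_space (price_states D))"
    by measurable
  note [measurable] = measurable_compose[OF fstm measurable_gR] measurable_compose[OF fstm measurable_gL]
  have fin: "countable (price_states D)"
    using D by (auto simp: bidding_problem_def countable_finite)
  have meas: "(\<lambda>z. f (next_state D (r, l, b1, b2, p) (fst z) (fst (snd z)))) \<in> borel_measurable ?L"
    unfolding next_state.simps
  proof (rule measurable_compose_countable'[OF _ sndm fin])
    fix p'
    show "(\<lambda>z. f (gR D r (fst z) b1, gL D l (fst z) b1, b2, p')) \<in> borel_measurable ?L"
      by (rule measurable_compose_countable[where g = "\<lambda>z. gR D r (fst z) b1"];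
          (rule measurable_compose_countable[where g = "\<lambda>z. gL D l (fst z) b1"])?) measurable
  qed
  show ?thesis
  proof (rule integrable_const_bound[OF _ meas])
    show "AE z in ?L. norm (f (next_state D (r, l, b1, b2, p) (fst z) (fst (snd z)))) \<le> (\<Sum>s\<in>states D. \<bar>f s\<bar>)"
    proof (rule AE_I2)
      fix z assume "z \<in> space ?L"
      then have "next_state D (r, l, b1, b2, p) (fst z) (fst (snd z)) \<in> states D"
        by (intro next_state_in_states D x price_law_space[OF D p])
      then show "norm (f (next_state D (r, l, b1, b2, p) (fst z) (fst (snd z)))) \<le> (\<Sum>s\<in>states D. \<bar>f s\<bar>)"
        unfolding real_norm_def using finite_states(1)[OF D(1)]
        by (intro member_le_sum[where f = "\<lambda>s. \<bar>f s\<bar>"]) auto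
    qed
  qed
qed

text \<open>
  The transition is a probability kernel on a finite set of states, so its action is a contraction
  for the maximum norm; this gives both the continuity and the bounds used for the Bellman step.
\<close>

lemma expect_next_diff_le:
  assumes D: "bidding_problem D" "t < horizon D" and x: "x \<in> post_states D"
    and le: "\<And>s. s \<in> states D \<Longrightarrow> \<bar>f s - g s\<bar> \<le> e"
  shows "\<bar>expect_next D t f x - expect_next D t g x\<bar> \<le> e"
proof -
  obtain r l b1 b2 p where x_eq: "x = (r, l, b1, b2, p)" by (cases x)
  have p: "p \<in> price_states D" using x by (simp add: x_eq post_states_members)
  interpret prob_space "price_law D t p" by (rule price_lawD[OF D p])
  let ?n = "\<lambda>z. next_state D x (fst z) (fst (snd z))"
  have int: "integrable (price_law D t p) (\<lambda>z. h (?n z))" for h :: "'a state \<Rightarrow> real"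
    unfolding x_eq using D x unfolding x_eq by (rule integrable_next_state)
  have "expect_next D t f x - expect_next D t g x = expectation (\<lambda>z. f (?n z) - g (?n z))"
    unfolding x_eq expect_next_eq using int unfolding x_eq by simp
  also have "\<bar>\<dots>\<bar> \<le> expectation (\<lambda>z. \<bar>f (?n z) - g (?n z)\<bar>)"
    by (rule integral_abs_bound)
  also have "\<dots> \<le> expectation (\<lambda>_. e)"
  proof (rule integral_mono)
    fix z assume "z \<in> space (price_law D t p)"
    then show "\<bar>f (?n z) - g (?n z)\<bar> \<le> e"
      by (intro le next_state_in_states D x price_law_space[OF D p])
  qed (use int in auto)
  finally show ?thesis by (simp add: prob_space)
qed

lemma expect_next_tendsto:
  assumes D: "bidding_problem D" "t < horizon D" and x: "x \<in> post_states D"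
    and lim: "\<And>s. s \<in> states D \<Longrightarrow> (\<lambda>n. f n s) \<longlonglongrightarrow> g s"
  shows "(\<lambda>n. expect_next D t (f n) x) \<longlonglongrightarrow> expect_next D t g x"
proof (rule LIM_zero_cancel, rule tendsto_0_le[where K = 1])
  have "(\<lambda>n. \<bar>f n s - g s\<bar>) \<longlonglongrightarrow> 0" if "s \<in> states D" for s
    using tendsto_rabs_zero[OF LIM_zero[OF lim[OF that]]] .
  then show "(\<lambda>n. \<Sum>s\<in>states D. \<bar>f n s - g s\<bar>) \<longlonglongrightarrow> 0"
    by (rule tendsto_null_sum)
  show "\<forall>\<^sub>F n in sequentially. norm (expect_next D t (f n) x - expect_next D t g x)
      \<le> norm (\<Sum>s\<in>states D. \<bar>f n s - g s\<bar>) * 1"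
  proof (rule always_eventually, rule allI)
    fix n
    have "\<bar>expect_next D t (f n) x - expect_next D t g x\<bar> \<le> (\<Sum>s\<in>states D. \<bar>f n s - g s\<bar>)"
    proof (rule expect_next_diff_le[OF D x])
      fix s assume "s \<in> states D"
      then show "\<bar>f n s - g s\<bar> \<le> (\<Sum>s\<in>states D. \<bar>f n s - g s\<bar>)"
        using finite_states(1)[OF D(1)]
        by (intro member_le_sum[where f = "\<lambda>s. \<bar>f n s - g s\<bar>"]) auto
    qed
    then show "norm (expect_next D t (f n) x - expect_next D t g x)
      \<le> norm (\<Sum>s\<in>states D. \<bar>f n s - g s\<bar>) * 1" by simp
  qed
qed

section \<open>Monotonicity of the optimal value function\<close>

definition increasing_in_state :: "('p, 'z) bidding_model_scheme \<Rightarrow> ('p state \<Rightarrow> real) \<Rightarrow> bool" where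
  "increasing_in_state D f \<longleftrightarrow> (\<forall>r l b r' l' b' p. (r, l, b, p) \<in> states D \<longrightarrow> (r', l', b', p) \<in> states D \<longrightarrow>
     r \<le> r' \<longrightarrow> l \<le> l' \<longrightarrow> bid_le b b' \<longrightarrow> f (r, l, b, p) \<le> f (r', l', b', p))"

text \<open>
  For one and the same price vector the transitions preserve the order: higher bids sell less and buy more,
  so the energy level and the remaining battery life stay ordered.
\<close>

lemma expect_next_mono:
  assumes D: "bidding_problem D" "t < horizon D" and f: "increasing_in_state D f"
    and x: "x \<in> post_states D" and y: "y \<in> post_states D" and le: "post_le x y"
  shows "expect_next D t f x \<le> expect_next D t f y"
proof -
  obtain r l b1 b2 p where x_eq: "x = (r, l, b1, b2, p)" by (cases x)
  obtain r' l' b1' b2' where y_eq: "y = (r', l', b1', b2', p)"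
    using le by (cases y) (auto simp: x_eq post_le_def)
  have p: "p \<in> price_states D" using x by (simp add: x_eq post_states_members)
  have ord: "r \<le> r'" "l \<le> l'" "bid_le b1 b1'" "bid_le b2 b2'"
    using le by (auto simp: x_eq y_eq post_le_def)
  show ?thesis
    unfolding x_eq y_eq expect_next_eq
  proof (rule integral_mono)
    show "integrable (price_law D t p) (\<lambda>z. f (next_state D (r, l, b1, b2, p) (fst z) (fst (snd z))))"
      using D x unfolding x_eq by (rule integrable_next_state)
    show "integrable (price_law D t p) (\<lambda>z. f (next_state D (r', l', b1', b2', p) (fst z) (fst (snd z))))"
      using D y unfolding y_eq by (rule integrable_next_state)
    fix z assume z: "z \<in> space (price_law D t p)"
    have "next_state D x (fst z) (fst (snd z)) \<in> states D" "next_state D y (fst z) (fst (snd z)) \<in> states D"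
      by (rule next_state_in_states[OF D(1) _ price_law_space[OF D p z]], fact x y)+
    moreover have "gR D r (fst z) b1 \<le> gR D r' (fst z) b1'" "gL D l (fst z) b1 \<le> gL D l' (fst z) b1'"
      unfolding gR_def gL_def using ord
      by (simp_all add: gR_step_mono gL_step_mono q_at_antimono d_at_antimono)
    ultimately show "f (next_state D (r, l, b1, b2, p) (fst z) (fst (snd z))) \<le>
        f (next_state D (r', l', b1', b2', p) (fst z) (fst (snd z)))"
      using f ord(4) unfolding x_eq y_eq increasing_in_state_def next_state.simps by blast
  qed
qed

text \<open>
  Only the terms for sales depend on r and l. A sale earns \<open>beta l * P\<close> if energy is left and costs
  \<open>penalty * beta l * P\<close> if not. More energy can only turn the cost into earnings, and the earnings grow with l; but so does the
  cost, unless the penalty vanishes or beta is constant.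
\<close>

lemma revenue_mono:
  assumes D: "bidding_problem D" and K: "penalty D = 0 \<or> beta D constant_on {..Lmax D}"
    and r: "r \<le> r'" and l: "l \<le> l'" "l' \<le> Lmax D"
    and P: "\<And>m. m \<in> {1..settlements D} \<Longrightarrow> 0 \<le> P m"
  shows "revenue D r l P b \<le> revenue D r' l' P b"
  unfolding revenue_def
proof (rule sum_mono)
  fix m assume m: "m \<in> {1..settlements D}"
  define \<rho> where "\<rho> r = gR_step D m r (q_at P b)" for r
  define \<kappa> where "\<kappa> l = gL_step m l (d_at P b)" for l
  have \<rho>: "\<rho> r \<le> \<rho> r'" using r by (simp add: \<rho>_def gR_step_mono)
  have \<kappa>: "\<kappa> l \<le> \<kappa> l'" "\<kappa> l' \<le> Lmax D" "\<kappa> l \<le> Lmax D"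
    using l gL_step_le[of m l' P b] gL_step_le[of m l P b] by (auto simp: \<kappa>_def gL_step_mono)
  have \<beta>: "beta D (\<kappa> l) \<le> beta D (\<kappa> l')" "0 \<le> beta D (\<kappa> l)"
    using D \<kappa> by (auto simp: bidding_problem_def mono_on_def image_subset_iff)
  have \<beta>K: "penalty D = 0 \<or> beta D (\<kappa> l) = beta D (\<kappa> l')"
    using K \<kappa> by (auto simp: constant_on_def)
  have K0: "0 \<le> penalty D" using D by (simp add: bidding_problem_def)
  have "gamma_at D m (\<kappa> l) P b * P m * of_int (q_at P b m) * U_at D m (\<rho> r) P b
      \<le> gamma_at D m (\<kappa> l') P b * P m * of_int (q_at P b m) * U_at D m (\<rho> r') P b"
  proof (cases "q_at P b m = 1")
    case True
    have "beta D (\<kappa> l) * (1 - (penalty D + 1) * of_bool (\<rho> r = 0)) \<le>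
        beta D (\<kappa> l') * (1 - (penalty D + 1) * of_bool (\<rho> r' = 0))"
    proof (cases "\<rho> r' = 0")
      case True
      then show ?thesis using \<rho> \<beta>K by auto
    next
      case False
      have "beta D (\<kappa> l) * (1 - (penalty D + 1) * of_bool (\<rho> r = 0)) \<le> beta D (\<kappa> l)"
        using \<beta>(2) K0 mult_left_mono[of "1 - (penalty D + 1) * of_bool (\<rho> r = 0)" 1 "beta D (\<kappa> l)"] by simp
      then show ?thesis using \<beta> False by simp
    qed
    from mult_left_mono[OF this P[OF m]] show ?thesis
      using True by (simp add: gamma_at_def U_at_def mult_ac)
  qed (simp add: gamma_at_def U_at_def)
  then show "gamma_at D m (gL_step m l (d_at P b)) P b * P m * of_int (q_at P b m) * U_at D m (gR_step D m r (q_at P b)) P b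
      \<le> gamma_at D m (gL_step m l' (d_at P b)) P b * P m * of_int (q_at P b m) * U_at D m (gR_step D m r' (q_at P b)) P b"
    by (simp add: \<rho>_def \<kappa>_def)
qed

lemma contribution_mono:
  assumes D: "bidding_problem D" "t < horizon D"
    and K: "penalty D = 0 \<or> beta D constant_on {..Lmax D}" and b: "b \<in> bids D"
  shows "increasing_in_state D (\<lambda>s. contribution D t s b)"
  unfolding increasing_in_state_def contribution_eq
proof (intro allI impI)
  fix r l b1 r' l' b1' p
  assume s: "(r, l, b1, p) \<in> states D" and s': "(r', l', b1', p) \<in> states D"
    and ord: "r \<le> r'" "l \<le> l'" "bid_le b1 b1'"
  have p: "p \<in> price_states D" using s by (simp add: states_members)
  show "(\<integral>z. revenue D (gR D r (fst z) b1) (gL D l (fst z) b1) (snd (snd z)) b \<partial>price_law D t p) \<le>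
      (\<integral>z. revenue D (gR D r' (fst z) b1') (gL D l' (fst z) b1') (snd (snd z)) b \<partial>price_law D t p)"
  proof (rule integral_mono_AE)
    show "AE z in price_law D t p. revenue D (gR D r (fst z) b1) (gL D l (fst z) b1) (snd (snd z)) b
        \<le> revenue D (gR D r' (fst z) b1') (gL D l' (fst z) b1') (snd (snd z)) b"
      using price_lawD(3)[OF D p]
    proof eventually_elim
      case (elim z)
      have "gL D l' (fst z) b1' \<le> Lmax D"
        using gL_le[of D l' "fst z" b1'] s' by (simp add: states_members)
      then show ?case
        using elim ord unfolding gR_def gL_def
        by (intro revenue_mono D K gR_step_mono gL_step_mono q_at_antimono d_at_antimono) auto
    qed
  qed (use s s' b in \<open>auto intro!: price_lawD(4)[OF D p] simp: states_members\<close>)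
qed

text \<open>
  Backward induction over the Bellman equation: every bid is at least as good from the larger state.
\<close>

lemma value_monotone_sufficient:
  assumes D: "bidding_problem D" and K: "penalty D = 0 \<or> beta D constant_on {..Lmax D}"
  shows "value_monotone D"
proof -
  have Vstar_mono: "increasing_in_state D (Vstar D t)" if "k = horizon D - t" for k t
    using that
  proof (induction k arbitrary: t)
    case 0
    then show ?case
      using D unfolding Vstar.simps[of D t] increasing_in_state_def bidding_problem_def by auto
  next
    case (Suc k)
    then have t: "t < horizon D" by simp
    have next_mono: "increasing_in_state D (Vstar D (Suc t))"
      using Suc by (intro Suc.IH) simp
    show ?case
      unfolding increasing_in_state_def
    proof (intro allI impI)
      fix r l b1 r' l' b1' p
      assume s: "(r, l, b1, p) \<in> states D" and s': "(r', l', b1', p) \<in> states D"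
        and ord: "r \<le> r'" "l \<le> l'" "bid_le b1 b1'"
      let ?J = "\<lambda>s b. contribution D t s b + expect_next D t (Vstar D (Suc t)) (to_post s b)"
      have bids: "finite (bids D)" "bids D \<noteq> {}"
        using D s by (auto simp: bidding_problem_def states_members)
      have "?J (r, l, b1, p) b \<le> Max (?J (r', l', b1', p) ` bids D)" if b: "b \<in> bids D" for b
      proof -
        have "?J (r, l, b1, p) b \<le> ?J (r', l', b1', p) b"
        proof (rule add_mono)
          show "contribution D t (r, l, b1, p) b \<le> contribution D t (r', l', b1', p) b"
            using contribution_mono[OF D t K b] s s' ord unfolding increasing_in_state_def by blast
          show "expect_next D t (Vstar D (Suc t)) (to_post (r, l, b1, p) b)
              \<le> expect_next D t (Vstar D (Suc t)) (to_post (r', l', b1', p) b)"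
            using s s' b ord
            by (intro expect_next_mono D t next_mono to_post_in_post_states) (auto simp: post_le_def bid_le_def)
        qed
        also have "\<dots> \<le> Max (?J (r', l', b1', p) ` bids D)"
          using bids b by (intro Max_ge) auto
        finally show ?thesis .
      qed
      then show "Vstar D t (r, l, b1, p) \<le> Vstar D t (r', l', b1', p)"
        using t bids unfolding Vstar.simps[of D t] by simp
    qed
  qed
  show ?thesis
    unfolding value_monotone_def Vpost_def using D Vstar_mono by (auto intro!: expect_next_mono)
qed

section \<open>Continuity and boundedness of the Bellman step\<close>

lemma tendsto_Max_image:
  fixes f :: "'i \<Rightarrow> 'a \<Rightarrow> real"
  assumes "finite B" "B \<noteq> {}" "\<And>b. b \<in> B \<Longrightarrow> ((\<lambda>n. f n b) \<longlongrightarrow> g b) F"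
  shows "((\<lambda>n. Max (f n ` B)) \<longlongrightarrow> Max (g ` B)) F"
  using assms
proof (induction rule: finite_ne_induct)
  case (insert b B)
  then show ?case by (simp add: tendsto_max)
qed simp

lemma observation_noise: "observation D v t x e = observation D v t x 0 + e"
  by (simp add: observation_def)

text \<open>
  With the optimal values in place of the estimates, the noise-free observation is the Bellman equation
  for \<open>Vpost\<close>.
\<close>

lemma observation_tendsto_Vpost:
  assumes D: "bidding_problem D" "Suc t < horizon D" and x: "x \<in> post_states D"
    and lim: "\<And>y. y \<in> post_states D \<Longrightarrow> (\<lambda>n. v n y) \<longlonglongrightarrow> Vpost D (Suc t) y"
  shows "(\<lambda>n. observation D (v n) t x 0) \<longlonglongrightarrow> Vpost D t x"
  unfolding observation_def Vpost_def add_0_right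
proof (rule expect_next_tendsto[OF D(1) _ x])
  show "t < horizon D" using D by simp
  fix s assume s: "s \<in> states D"
  have Vs: "Vstar D (Suc t) s = Max ((\<lambda>b. contribution D (Suc t) s b + Vpost D (Suc t) (to_post s b)) ` bids D)"
    using D by (subst Vstar.simps) (simp add: Vpost_def)
  have "finite (bids D)" "bids D \<noteq> {}"
    using D s by (cases s; auto simp: bidding_problem_def states_members)+
  then show "(\<lambda>n. Max ((\<lambda>b. contribution D (Suc t) s b + v n (to_post s b)) ` bids D)) \<longlonglongrightarrow> Vstar D (Suc t) s"
    unfolding Vs using s by (intro tendsto_Max_image tendsto_add tendsto_const lim to_post_in_post_states)
qed

lemma observation_bounded:
  assumes D: "bidding_problem D" "Suc t < horizon D"
  obtains H where "\<And>v x. x \<in> post_states D \<Longrightarrow> (\<And>y. y \<in> post_states D \<Longrightarrow> \<bar>v y\<bar> \<le> C) \<Longrightarrow>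
    \<bar>observation D v t x 0\<bar> \<le> H"
proof
  define K where "K = (\<Sum>z\<in>states D \<times> bids D. \<bar>contribution D (Suc t) (fst z) (snd z)\<bar>)"
  fix v x assume x: "x \<in> post_states D" and v: "\<And>y. y \<in> post_states D \<Longrightarrow> \<bar>v y\<bar> \<le> C"
  have bids: "finite (bids D)" using D by (simp add: bidding_problem_def)
  let ?J = "\<lambda>s b. contribution D (Suc t) s b + v (to_post s b)"
  have "\<bar>Max (?J s ` bids D) - 0\<bar> \<le> K + C" if s: "s \<in> states D" for s
  proof -
    have "bids D \<noteq> {}" using s by (cases s) (auto simp: states_members)
    then have "Max (?J s ` bids D) \<in> ?J s ` bids D"
      using bids by (intro Max_in) auto
    then obtain b where b: "Max (?J s ` bids D) = ?J s b" "b \<in> bids D"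
      by (rule imageE)
    have "\<bar>contribution D (Suc t) s b\<bar> \<le> K"
      unfolding K_def using member_le_sum[of "(s, b)" "states D \<times> bids D" "\<lambda>z. \<bar>contribution D (Suc t) (fst z) (snd z)\<bar>"]
        s b finite_states(1)[OF D(1)] bids by simp
    moreover have "\<bar>v (to_post s b)\<bar> \<le> C" by (intro v to_post_in_post_states s b)
    ultimately show ?thesis unfolding b(1) by linarith
  qed
  then have "\<bar>expect_next D t (\<lambda>s. Max (?J s ` bids D)) x - expect_next D t (\<lambda>s. 0) x\<bar> \<le> K + C"
    using D x by (intro expect_next_diff_le) auto
  moreover have "expect_next D t (\<lambda>s. 0) x = 0" by (cases x) (simp add: expect_next_eq)
  ultimately show "\<bar>observation D v t x 0\<bar> \<le> K + C" by (simp add: observation_def)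
qed

section \<open>The run of the algorithm\<close>

lemma adp_runD:
  assumes "adp_run D N S w"
  shows "prob_space N"
    and "t < horizon D \<Longrightarrow> S (Suc n) t \<in> measurable N (count_space (post_states D))"
    and "Suc t < horizon D \<Longrightarrow> s \<in> post_states D \<Longrightarrow> w (Suc n) t s \<in> borel_measurable N"
    and "Suc t < horizon D \<Longrightarrow> s \<in> post_states D \<Longrightarrow> A \<in> sets borel \<Longrightarrow>
      AE \<omega> in N. real_cond_exp N (filt D N S w n)
          (indicator ({\<omega> \<in> space N. S (Suc n) t \<omega> = s} \<inter> {\<omega> \<in> space N. w (Suc n) t s \<omega> \<in> A})) \<omega> =
        real_cond_exp N (filt D N S w n) (indicator {\<omega> \<in> space N. S (Suc n) t \<omega> = s}) \<omega> *
        real_cond_exp N (filt D N S w n) (indicator {\<omega> \<in> space N. w (Suc n) t s \<omega> \<in> A}) \<omega>"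
  using assms unfolding adp_run_def prob_given_def Let_def by auto

lemma visited_state:
  assumes "adp_run D N S w" "t < horizon D" "\<omega> \<in> space N"
  shows "S (Suc n) t \<omega> \<in> post_states D"
  using measurable_space[OF adp_runD(2)[OF assms(1,2)] assms(3)] by simp

text \<open>
  Naming the generators separately lets the inclusions of sigma-algebras be reduced to inclusions of
  generators.
\<close>

definition filt_generators ::
  "('p, 'z) bidding_model_scheme \<Rightarrow> 'w measure \<Rightarrow> (nat \<Rightarrow> nat \<Rightarrow> 'w \<Rightarrow> 'p post_state) \<Rightarrow>
   (nat \<Rightarrow> nat \<Rightarrow> 'p post_state \<Rightarrow> 'w \<Rightarrow> real) \<Rightarrow> nat \<Rightarrow> 'w set set" where
  "filt_generators D N S w n =
     {S m t -` {s} \<inter> space N | m t s. m \<in> {1..n} \<and> t < horizon D \<and> s \<in> post_states D} \<union>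
     {(\<lambda>\<omega>. w m t (S m t \<omega>) \<omega>) -` A \<inter> space N | m t A.
         m \<in> {1..n} \<and> Suc t < horizon D \<and> A \<in> sets (borel :: real measure)}"

lemma filt_eq: "filt D N S w n = sigma (space N) (filt_generators D N S w n)"
  by (simp add: filt_def filt_generators_def)

lemma sets_filt: "sets (filt D N S w n) = sigma_sets (space N) (filt_generators D N S w n)"
  unfolding filt_eq by (rule sets_measure_of) (auto simp: filt_generators_def)

lemma space_filt: "space (filt D N S w n) = space N"
  unfolding filt_eq by (rule space_measure_of) (auto simp: filt_generators_def)

lemma measurable_visited_noise:
  assumes D: "bidding_problem D" and run: "adp_run D N S w" and t: "Suc t < horizon D"
  shows "(\<lambda>\<omega>. w (Suc n) t (S (Suc n) t \<omega>) \<omega>) \<in> borel_measurable N"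
  using t by (intro measurable_compose_countable'[OF adp_runD(3)[OF run t] adp_runD(2)[OF run]]
      countable_finite finite_states(2)[OF D]) auto

lemma subalgebra_filt:
  assumes D: "bidding_problem D" and run: "adp_run D N S w"
  shows "subalgebra N (filt D N S w n)"
proof -
  have "filt_generators D N S w n \<subseteq> sets N"
  proof
    fix B assume "B \<in> filt_generators D N S w n"
    then consider (visit) m t s where "m \<in> {1..n}" "t < horizon D" "s \<in> post_states D" "B = S m t -` {s} \<inter> space N"
      | (noise) m t A where "m \<in> {1..n}" "Suc t < horizon D" "A \<in> sets borel" "B = (\<lambda>\<omega>. w m t (S m t \<omega>) \<omega>) -` A \<inter> space N"
      unfolding filt_generators_def by blast
    then show "B \<in> sets N"
    proof cases
      case visit
      then obtain k where "m = Suc k" by (cases m) auto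
      with visit show ?thesis using adp_runD(2)[OF run, of t k] by (auto intro: measurable_sets)
    next
      case noise
      then obtain k where "m = Suc k" by (cases m) auto
      with noise show ?thesis using measurable_visited_noise[OF D run, of t k] by (auto intro: measurable_sets)
    qed
  qed
  then show ?thesis
    unfolding subalgebra_def space_filt sets_filt by (simp add: sets.sigma_sets_subset)
qed

lemma subalgebra_filt_Suc: "subalgebra (filt D N S w (Suc n)) (filt D N S w n)"
  unfolding subalgebra_def space_filt sets_filt
proof (intro conjI refl sigma_sets_mono')
  show "filt_generators D N S w n \<subseteq> filt_generators D N S w (Suc n)"
    unfolding filt_generators_def by (intro Un_mono) (force simp: le_Suc_eq)+
qed

lemma visit_in_filt:
  assumes "t < horizon D" "s \<in> post_states D"
  shows "{\<omega> \<in> space N. S (Suc n) t \<omega> = s} \<in> sets (filt D N S w (Suc n))"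
proof -
  have "S (Suc n) t -` {s} \<inter> space N \<in> filt_generators D N S w (Suc n)"
    unfolding filt_generators_def using assms
    by (intro UnI1 CollectI exI[of _ "Suc n"] exI[of _ t] exI[of _ s]) auto
  moreover have "{\<omega> \<in> space N. S (Suc n) t \<omega> = s} = S (Suc n) t -` {s} \<inter> space N" by auto
  ultimately show ?thesis unfolding sets_filt by auto
qed

lemma visited_noise_measurable_filt:
  assumes "Suc t < horizon D"
  shows "(\<lambda>\<omega>. w (Suc n) t (S (Suc n) t \<omega>) \<omega>) \<in> borel_measurable (filt D N S w (Suc n))"
proof (rule measurableI)
  fix A :: "real set" assume "A \<in> sets borel"
  then have "(\<lambda>\<omega>. w (Suc n) t (S (Suc n) t \<omega>) \<omega>) -` A \<inter> space N \<in> filt_generators D N S w (Suc n)"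
    unfolding filt_generators_def using assms
    by (intro UnI2 CollectI exI[of _ "Suc n"] exI[of _ t] exI[of _ A]) auto
  then show "(\<lambda>\<omega>. w (Suc n) t (S (Suc n) t \<omega>) \<omega>) -` A \<inter> space (filt D N S w (Suc n)) \<in> sets (filt D N S w (Suc n))"
    unfolding sets_filt space_filt by auto
qed simp

text \<open>
  Every new estimate is an average of an old one and an observation, a copy of such an average, or an old
  one.
\<close>

lemma Vbar_bounded:
  assumes \<alpha>: "\<And>n t. t < horizon D \<Longrightarrow> \<alpha> n t \<omega> \<in> {0..1}"
    and S: "\<And>n t. t < horizon D \<Longrightarrow> S (Suc n) t \<omega> \<in> post_states D"
    and Vpost: "\<And>t s. t < horizon D \<Longrightarrow> s \<in> post_states D \<Longrightarrow> \<bar>Vpost D t s\<bar> \<le> C"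
    and obs: "\<And>n t. Suc t < horizon D \<Longrightarrow> \<bar>vhat D \<alpha> S w (Suc n) t \<omega>\<bar> \<le> C"
    and "0 \<le> C" "t < horizon D" "s \<in> post_states D"
  shows "\<bar>Vbar D \<alpha> S w n \<omega> t s\<bar> \<le> C"
  using \<open>s \<in> post_states D\<close> \<open>t < horizon D\<close>
proof (induction n arbitrary: s t)
  case (Suc n)
  show ?case
  proof (cases "Suc t < horizon D")
    case True
    let ?x = "S (Suc n) t \<omega>" and ?v = "Vbar D \<alpha> S w n \<omega> t"
    let ?z = "(1 - \<alpha> n t \<omega>) * ?v ?x + \<alpha> n t \<omega> * vhat D \<alpha> S w (Suc n) t \<omega>"
    have "?v ?x \<in> {-C..C}" "vhat D \<alpha> S w (Suc n) t \<omega> \<in> {-C..C}"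
      using Suc.IH[OF S[OF Suc.prems(2)] Suc.prems(2), of n] obs[OF True, of n]
      unfolding atLeastAtMost_iff by linarith+
    then have "?z \<in> {-C..C}"
      using convexD_alt[OF convex_real_interval(5)[of "-C" C], of "?v ?x" "vhat D \<alpha> S w (Suc n) t \<omega>" "\<alpha> n t \<omega>"]
        \<alpha>[OF Suc.prems(2)] by simp
    moreover have "Vbar D \<alpha> S w (Suc n) \<omega> t s = mono_op ?x ?z s (?v s)"
      using True by (simp add: Let_def state_step_def vhat_def)
    moreover have "\<bar>?v s\<bar> \<le> C" using Suc by blast
    ultimately show ?thesis by (auto simp: mono_op_def)
  qed (use Suc.prems Vpost in simp)
qed (use Vpost \<open>0 \<le> C\<close> in simp)

text \<open>
  The noise observed along the run is known after the iteration, whereas \<open>w (Suc n) t s\<close> itself need not be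
  measurable in the filtration. The two agree on the visits to s, so each term can be read in
  the first way for measurability and boundedness and in the second way for the conditional mean.
\<close>

lemma visited_noise_summable:
  fixes S :: "nat \<Rightarrow> nat \<Rightarrow> 'w \<Rightarrow> 'p post_state" and w :: "nat \<Rightarrow> nat \<Rightarrow> 'p post_state \<Rightarrow> 'w \<Rightarrow> real"
  assumes D: "bidding_problem D" and run: "adp_run D N S w"
    and t: "Suc t < horizon D" and s: "s \<in> post_states D"
    and \<alpha>: "\<And>n \<omega>. \<omega> \<in> space N \<Longrightarrow> \<alpha> n t \<omega> \<in> {0..1}"
    and \<alpha>_meas: "\<And>n. \<alpha> n t \<in> borel_measurable (filt D N S w n)"
    and sq: "AE \<omega> in N. summable (\<lambda>n. (\<alpha> n t \<omega> * of_bool (s = S (Suc n) t \<omega>))\<^sup>2)"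
    and int: "\<And>n. integrable N (w (Suc n) t s)"
    and zero: "\<And>n. AE \<omega> in N. real_cond_exp N (filt D N S w n) (w (Suc n) t s) \<omega> = 0"
    and bound: "AE \<omega> in N. \<forall>n. \<bar>w (Suc n) t (S (Suc n) t \<omega>) \<omega>\<bar> \<le> B"
  shows "AE \<omega> in N. summable (\<lambda>n. \<alpha> n t \<omega> * of_bool (s = S (Suc n) t \<omega>) * w (Suc n) t s \<omega>)"
proof -
  interpret prob_space N by (rule adp_runD[OF run])
  let ?F = "filt D N S w"
  let ?V = "\<lambda>n. {\<omega> \<in> space N. S (Suc n) t \<omega> = s}"
  note sub = subalgebra_filt[OF D run]
  have t': "t < horizon D" using t by simp
  have VF: "?V n \<in> sets (?F (Suc n))" for n
    using t' s by (rule visit_in_filt)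
  have VN: "?V n \<in> sets N" for n
    using VF sub by (auto simp: subalgebra_def)
  define \<xi> where "\<xi> n \<omega> = \<alpha> n t \<omega> * (indicator (?V n) \<omega> * w (Suc n) t s \<omega>)" for n \<omega>
  have \<xi>_eq: "\<xi> n \<omega> = \<alpha> n t \<omega> * of_bool (s = S (Suc n) t \<omega>) * w (Suc n) t s \<omega>"
      "\<xi> n \<omega> = \<alpha> n t \<omega> * of_bool (s = S (Suc n) t \<omega>) * w (Suc n) t (S (Suc n) t \<omega>) \<omega>"
    if "\<omega> \<in> space N" for n \<omega>
    using that by (auto simp: \<xi>_def indicator_def)
  have "AE \<omega> in N. summable (\<lambda>n. \<xi> n \<omega>)"
  proof (rule AE_summable_martingale_differences[where F = ?F and B = B, OF sub subalgebra_filt_Suc])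
    fix n
    have [measurable]: "\<alpha> n t \<in> borel_measurable (?F (Suc n))" "?V n \<in> sets (?F (Suc n))"
        "(\<lambda>\<omega>. w (Suc n) t (S (Suc n) t \<omega>) \<omega>) \<in> borel_measurable (?F (Suc n))"
      using measurable_from_subalg[OF subalgebra_filt_Suc \<alpha>_meas] VF visited_noise_measurable_filt[OF t] by auto
    have "(\<lambda>\<omega>. \<alpha> n t \<omega> * indicator (?V n) \<omega> * w (Suc n) t (S (Suc n) t \<omega>) \<omega>) \<in> borel_measurable (?F (Suc n))"
      by measurable
    then show "\<xi> n \<in> borel_measurable (?F (Suc n))"
      by (rule measurable_cong[THEN iffD1, rotated]) (auto simp: \<xi>_def indicator_def space_filt)
    show "AE \<omega> in N. \<bar>\<xi> n \<omega>\<bar> \<le> B"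
      using bound AE_space
    proof eventually_elim
      case (elim \<omega>)
      let ?w = "w (Suc n) t (S (Suc n) t \<omega>) \<omega>"
      have "\<bar>\<xi> n \<omega>\<bar> \<le> 1 * \<bar>?w\<bar>"
        unfolding \<xi>_eq(2)[OF elim(2)] abs_mult using \<alpha>[OF elim(2)] by (intro mult_right_mono) auto
      with elim(1) show ?case by (auto intro: order_trans)
    qed
    interpret finite_measure_subalgebra N "?F n" by standard (rule sub)
    have int': "integrable N (\<lambda>\<omega>. indicator (?V n) \<omega> * w (Suc n) t s \<omega>)"
      using integrable_mult_indicator[OF VN int] by simp
    have \<alpha>N: "\<alpha> n t \<in> borel_measurable N"
      by (rule measurable_from_subalg[OF sub \<alpha>_meas])
    have "AE \<omega> in N. real_cond_exp N (?F n) (\<lambda>\<omega>. indicator (?V n) \<omega> * w (Suc n) t s \<omega>) \<omega> = 0"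
      by (rule cond_exp_indicator_times_zero[OF sub VN int adp_runD(4)[OF run t s] zero])
    moreover have "AE \<omega> in N. real_cond_exp N (?F n) (\<xi> n) \<omega> =
        \<alpha> n t \<omega> * real_cond_exp N (?F n) (\<lambda>\<omega>. indicator (?V n) \<omega> * w (Suc n) t s \<omega>) \<omega>"
      unfolding \<xi>_def[abs_def]
    proof (rule real_cond_exp_mult[OF \<alpha>_meas])
      show "integrable N (\<lambda>\<omega>. \<alpha> n t \<omega> * (indicator (?V n) \<omega> * w (Suc n) t s \<omega>))"
      proof (rule Bochner_Integration.integrable_bound[OF int'])
        show "AE \<omega> in N. norm (\<alpha> n t \<omega> * (indicator (?V n) \<omega> * w (Suc n) t s \<omega>))
            \<le> norm (indicator (?V n) \<omega> * w (Suc n) t s \<omega>)"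
          using \<alpha> by (intro AE_I2) (auto simp: abs_mult intro!: mult_left_le_one_le)
        show "(\<lambda>\<omega>. \<alpha> n t \<omega> * (indicator (?V n) \<omega> * w (Suc n) t s \<omega>)) \<in> borel_measurable N"
          using \<alpha>N int' by (intro borel_measurable_times[OF \<alpha>N borel_measurable_integrable])
      qed
    qed (use int' in auto)
    ultimately show "AE \<omega> in N. real_cond_exp N (?F n) (\<xi> n) \<omega> = 0"
      by eventually_elim simp
  next
    show "AE \<omega> in N. summable (\<lambda>n. (\<xi> n \<omega>)\<^sup>2)"
      using sq bound AE_space
    proof eventually_elim
      case (elim \<omega>)
      show ?case
      proof (rule summable_comparison_test'[OF summable_mult[OF elim(1), of "B\<^sup>2"]])
        fix n
        have "(w (Suc n) t (S (Suc n) t \<omega>) \<omega>)\<^sup>2 \<le> B\<^sup>2"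
          using elim(2) by (metis abs_ge_zero order_trans power2_le_iff_abs_le)
        then show "norm ((\<xi> n \<omega>)\<^sup>2) \<le> B\<^sup>2 * (\<alpha> n t \<omega> * of_bool (s = S (Suc n) t \<omega>))\<^sup>2"
          unfolding \<xi>_eq(2)[OF elim(3)] by (simp add: power_mult_distrib mult_right_mono mult.commute)
      qed
    qed
  qed
  then show ?thesis
    using AE_space by eventually_elim (simp add: \<xi>_eq(1))
qed

text \<open>
  The pathwise part: backward induction over t, where the limit at t+1 supplies the limit of the
  noise-free observations h at t.
\<close>

lemma Vbar_tendsto_Vpost:
  assumes D: "bidding_problem D" and mono: "value_monotone D"
    and \<alpha>: "\<And>n t. t < horizon D \<Longrightarrow> \<alpha> n t \<omega> \<in> {0..1}"
    and S: "\<And>n t. t < horizon D \<Longrightarrow> S (Suc n) t \<omega> \<in> post_states D"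
    and div: "\<And>t s. t < horizon D \<Longrightarrow> s \<in> post_states D \<Longrightarrow>
      \<not> summable (\<lambda>n. \<alpha> n t \<omega> * of_bool (s = S (Suc n) t \<omega>))"
    and noise: "\<And>t s. Suc t < horizon D \<Longrightarrow> s \<in> post_states D \<Longrightarrow>
      summable (\<lambda>n. \<alpha> n t \<omega> * of_bool (s = S (Suc n) t \<omega>) * w (Suc n) t s \<omega>)"
    and t: "t < horizon D" and s: "s \<in> post_states D"
  shows "(\<lambda>n. Vbar D \<alpha> S w n \<omega> t s) \<longlonglongrightarrow> Vpost D t s"
proof -
  have "k = horizon D - Suc t \<Longrightarrow> ?thesis" for k
    using t s
  proof (induction k arbitrary: t s)
    case 0
    then have "Vbar D \<alpha> S w n \<omega> t s = Vpost D t s" for n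
      by (cases n) auto
    then show ?case by simp
  next
    case (Suc k)
    then have t: "Suc t < horizon D" by simp
    let ?v = "\<lambda>n. Vbar D \<alpha> S w n \<omega> t"
    have step: "?v (Suc n) r = mono_op (S (Suc n) t \<omega>) (?v (Suc n) (S (Suc n) t \<omega>)) r (?v n r)" for n r
      using t by (simp add: Let_def mono_op_def)
    show ?case
    proof (rule monotone_relaxation_tendsto[where X = "post_states D" and le = post_le and a = "\<lambda>n. \<alpha> n t \<omega>"
          and x = "\<lambda>n. S (Suc n) t \<omega>" and w = "\<lambda>n r. w (Suc n) t r \<omega>"
          and h = "\<lambda>n r. observation D (Vbar D \<alpha> S w n \<omega> (Suc t)) t r 0"])
      \<comment> \<open>The stepsize used in iteration n+1 is the one with index n.\<close>
      show "?v (Suc n) (S (Suc n) t \<omega>) = (1 - \<alpha> n t \<omega>) * ?v n (S (Suc n) t \<omega>) + \<alpha> n t \<omega> *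
          (observation D (Vbar D \<alpha> S w n \<omega> (Suc t)) t (S (Suc n) t \<omega>) 0 + w (Suc n) t (S (Suc n) t \<omega>) \<omega>)" for n
        using t observation_noise[of D _ t _ "w (Suc n) t (S (Suc n) t \<omega>) \<omega>"]
        by (simp add: Let_def mono_op_def state_step_def)
      show "?v (Suc n) r = max (?v (Suc n) (S (Suc n) t \<omega>)) (?v n r)"
        if "r \<noteq> S (Suc n) t \<omega>" "post_le (S (Suc n) t \<omega>) r" for n r
        using that by (subst step) (simp add: mono_op_def)
      show "?v (Suc n) r = min (?v (Suc n) (S (Suc n) t \<omega>)) (?v n r)"
        if "r \<noteq> S (Suc n) t \<omega>" "post_le r (S (Suc n) t \<omega>)" for n r
        using that post_le_antisym[of r "S (Suc n) t \<omega>"] by (subst step) (auto simp: mono_op_def)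
      show "?v (Suc n) r = ?v n r"
        if "\<not> post_le r (S (Suc n) t \<omega>)" "\<not> post_le (S (Suc n) t \<omega>) r" for n r
        using that post_le_refl[of r] by (subst step) (auto simp: mono_op_def)
      show "(\<lambda>n. observation D (Vbar D \<alpha> S w n \<omega> (Suc t)) t r 0) \<longlonglongrightarrow> Vpost D t r"
        if "r \<in> post_states D" for r
        using Suc.IH[of "Suc t"] Suc.prems t
        by (intro observation_tendsto_Vpost[OF D t that]) auto
      show "Vpost D t r \<le> Vpost D t u" if "r \<in> post_states D" "u \<in> post_states D" "post_le r u" for r u
        using mono t that by (auto simp: value_monotone_def)
      show "post_le r u" if "post_le r s" "post_le s u" for r s u
        using that by (rule post_le_trans)
      show "r = u" if "post_le r u" "post_le u r" for r u
        using that by (rule post_le_antisym)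
    qed (use finite_states(2)[OF D] post_le_refl \<alpha> S div noise t Suc.prems in auto)
  qed
  then show ?thesis by simp
qed

section \<open>Convergence of the algorithm\<close>

theorem theorem2:
  fixes D :: "'p bidding_model"
    and N :: "'w measure"
    and S :: "nat \<Rightarrow> nat \<Rightarrow> 'w \<Rightarrow> 'p post_state"
    and w :: "nat \<Rightarrow> nat \<Rightarrow> 'p post_state \<Rightarrow> 'w \<Rightarrow> real"
    and \<alpha> :: "nat \<Rightarrow> nat \<Rightarrow> 'w \<Rightarrow> real"
    and Vmax :: real
  assumes model: "bidding_problem D"
    and run: "adp_run D N S w"
    and monotone: "penalty D = 0 \<or> beta D constant_on {..Lmax D} \<or> value_monotone D"
    and A4_range: "\<And>n t \<omega>. t < horizon D \<Longrightarrow> \<omega> \<in> space N \<Longrightarrow> \<alpha> n t \<omega> \<in> {0..1}"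
    and A4_meas: "\<And>n t. t < horizon D \<Longrightarrow> \<alpha> n t \<in> borel_measurable (filt D N S w n)"
    and A4_sum: "\<And>t s. t < horizon D \<Longrightarrow> s \<in> post_states D \<Longrightarrow>
      AE \<omega> in N. (\<Sum>n. ennreal (state_step \<alpha> S (Suc n) t s \<omega>)) = \<infinity>"
    and A4_sum_sq: "\<And>t s. t < horizon D \<Longrightarrow> s \<in> post_states D \<Longrightarrow>
      AE \<omega> in N. (\<Sum>n. ennreal ((state_step \<alpha> S (Suc n) t s \<omega>)\<^sup>2)) < \<infinity>"
    and A5: "\<And>t s. t < horizon D \<Longrightarrow> s \<in> post_states D \<Longrightarrow>
      AE \<omega> in N. (\<Sum>n. ennreal (prob_given N (filt D N S w n)
        {\<omega>' \<in> space N. S (Suc n) t \<omega>' = s} \<omega>)) = \<infinity>"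
    and Vmax_pos: "0 < Vmax"
    and A6_value: "\<And>t s. t < horizon D \<Longrightarrow> s \<in> post_states D \<Longrightarrow> \<bar>Vpost D t s\<bar> \<le> Vmax"
    and A6_obs: "\<And>n t. Suc t < horizon D \<Longrightarrow>
      AE \<omega> in N. \<bar>vhat D \<alpha> S w (Suc n) t \<omega>\<bar> \<le> Vmax"
    and A7_integrable: "\<And>n t s. Suc t < horizon D \<Longrightarrow> s \<in> post_states D \<Longrightarrow>
      integrable N (w (Suc n) t s)"
    and A7: "\<And>n t s. Suc t < horizon D \<Longrightarrow> s \<in> post_states D \<Longrightarrow>
      AE \<omega> in N. real_cond_exp N (filt D N S w n) (w (Suc n) t s) \<omega> = 0"
  shows "\<forall>t < horizon D. \<forall>s \<in> post_states D.
    AE \<omega> in N. (\<lambda>n. Vbar D \<alpha> S w n \<omega> t s) \<longlonglongrightarrow> Vpost D t s"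
proof -
  have mono: "value_monotone D"
    using monotone value_monotone_sufficient[OF model] by blast
  have X: "finite (post_states D)" by (rule finite_states[OF model])
  have step_eq: "state_step \<alpha> S (Suc n) t s \<omega> = \<alpha> n t \<omega> * of_bool (s = S (Suc n) t \<omega>)" for n t s \<omega>
    by (simp add: state_step_def)
  have div: "AE \<omega> in N. \<not> summable (\<lambda>n. \<alpha> n t \<omega> * of_bool (s = S (Suc n) t \<omega>))"
    if "t < horizon D" "s \<in> post_states D" for t s
    using A4_sum[OF that] AE_space
  proof eventually_elim
    case (elim \<omega>)
    have nonneg: "0 \<le> \<alpha> n t \<omega> * of_bool (s = S (Suc n) t \<omega>)" for n
      using A4_range[OF that(1) elim(2), of n] by simp
    show ?case using elim(1) nonneg suminf_ennreal2[OF nonneg] by (auto simp: step_eq)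
  qed
  have sq: "AE \<omega> in N. summable (\<lambda>n. (\<alpha> n t \<omega> * of_bool (s = S (Suc n) t \<omega>))\<^sup>2)"
    if "t < horizon D" "s \<in> post_states D" for t s
    using A4_sum_sq[OF that]
    by eventually_elim (rule summable_suminf_not_top, auto simp: step_eq)
  have obs: "AE \<omega> in N. \<forall>t. Suc t < horizon D \<longrightarrow> (\<forall>n. \<bar>vhat D \<alpha> S w (Suc n) t \<omega>\<bar> \<le> Vmax)"
    using A6_obs by (simp add: AE_all_countable)
  \<comment> \<open>The observed noise is the observation minus its noise-free part, and both are bounded. Noise that is
    not observed need not be bounded.\<close>
  have noise_bound: "\<exists>B. AE \<omega> in N. \<forall>n. \<bar>w (Suc n) t (S (Suc n) t \<omega>) \<omega>\<bar> \<le> B"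
    if t: "Suc t < horizon D" for t
  proof -
    obtain H where H: "\<And>v x. x \<in> post_states D \<Longrightarrow> (\<And>y. y \<in> post_states D \<Longrightarrow> \<bar>v y\<bar> \<le> Vmax) \<Longrightarrow>
        \<bar>observation D v t x 0\<bar> \<le> H"
      using observation_bounded[OF model t] by blast
    have "AE \<omega> in N. \<forall>n. \<bar>w (Suc n) t (S (Suc n) t \<omega>) \<omega>\<bar> \<le> Vmax + H"
      using obs AE_space
    proof eventually_elim
      case (elim \<omega>)
      show ?case
      proof
        fix n
        have "\<bar>Vbar D \<alpha> S w n \<omega> (Suc t) y\<bar> \<le> Vmax" if "y \<in> post_states D" for y
        proof (rule Vbar_bounded)
          show "\<alpha> n t \<omega> \<in> {0..1}" if "t < horizon D" for n t
            by (rule A4_range[OF that elim(2)])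
          show "S (Suc n) t \<omega> \<in> post_states D" if "t < horizon D" for n t
            by (rule visited_state[OF run that elim(2)])
        qed (use elim(1) A6_value Vmax_pos t that in auto)
        then have "\<bar>observation D (Vbar D \<alpha> S w n \<omega> (Suc t)) t (S (Suc n) t \<omega>) 0\<bar> \<le> H"
          using t by (intro H visited_state[OF run _ elim(2)]) auto
        moreover have "vhat D \<alpha> S w (Suc n) t \<omega> =
            observation D (Vbar D \<alpha> S w n \<omega> (Suc t)) t (S (Suc n) t \<omega>) 0 + w (Suc n) t (S (Suc n) t \<omega>) \<omega>"
          unfolding vhat_def by (subst observation_noise) simp
        moreover have "\<bar>vhat D \<alpha> S w (Suc n) t \<omega>\<bar> \<le> Vmax" using elim(1) t by blast
        ultimately show "\<bar>w (Suc n) t (S (Suc n) t \<omega>) \<omega>\<bar> \<le> Vmax + H" by linarith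
      qed
    qed
    then show ?thesis by blast
  qed
  have noise: "AE \<omega> in N. summable (\<lambda>n. \<alpha> n t \<omega> * of_bool (s = S (Suc n) t \<omega>) * w (Suc n) t s \<omega>)"
    if t: "Suc t < horizon D" and s: "s \<in> post_states D" for t s
  proof -
    obtain B where B: "AE \<omega> in N. \<forall>n. \<bar>w (Suc n) t (S (Suc n) t \<omega>) \<omega>\<bar> \<le> B"
      using noise_bound[OF t] by blast
    show ?thesis
      by (rule visited_noise_summable[OF model run t s])
        (use t s A4_range A4_meas sq A7_integrable A7 B in auto)
  qed
  have "AE \<omega> in N. \<forall>s\<in>post_states D. \<forall>t. t < horizon D \<longrightarrow>
      \<not> summable (\<lambda>n. \<alpha> n t \<omega> * of_bool (s = S (Suc n) t \<omega>))"
    using div by (simp add: AE_finite_all[OF X] AE_all_countable)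
  moreover have "AE \<omega> in N. \<forall>s\<in>post_states D. \<forall>t. Suc t < horizon D \<longrightarrow>
      summable (\<lambda>n. \<alpha> n t \<omega> * of_bool (s = S (Suc n) t \<omega>) * w (Suc n) t s \<omega>)"
    using noise by (simp add: AE_finite_all[OF X] AE_all_countable)
  ultimately have "AE \<omega> in N. \<forall>t<horizon D. \<forall>s\<in>post_states D. (\<lambda>n. Vbar D \<alpha> S w n \<omega> t s) \<longlonglongrightarrow> Vpost D t s"
    using AE_space
  proof eventually_elim
    case (elim \<omega>)
    show ?case
    proof (intro allI impI ballI)
      fix t s assume t: "t < horizon D" and s: "s \<in> post_states D"
      show "(\<lambda>n. Vbar D \<alpha> S w n \<omega> t s) \<longlonglongrightarrow> Vpost D t s"
      proof (rule Vbar_tendsto_Vpost[OF model mono])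
        show "\<alpha> n t \<omega> \<in> {0..1}" if "t < horizon D" for n t
          by (rule A4_range[OF that elim(3)])
        show "S (Suc n) t \<omega> \<in> post_states D" if "t < horizon D" for n t
          by (rule visited_state[OF run that elim(3)])
      qed (use elim(1,2) t s in auto)
    qed
  qed
  then show ?thesis by (auto elim: eventually_mono)
qed

end
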